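(* Assume (A1), (A2) and $\overline H(0)=0$. Let $u$ be the viscosity solution of $u_t+H(x,Du)=0$ in $\mathbb{T}^n\times(0,\infty)$, $u(x,0)=g(x)$ on $\mathbb{T}^n$. Then there exists a viscosity solution $v\in\operatorname{Lip}(\mathbb{T}^n)$ of $H(x,Dv)=0$ in $\mathbb{T}^n$ such that $$\lim_{t\to\infty}\|u(\cdot,t)-v\|_{L^\infty(\mathbb{T}^n)}=0.$$
   Context: $\mathbb{T}^n=\mathbb{R}^n/\mathbb{Z}^n$; $H\in C^2(\mathbb{T}^n\times\mathbb{R}^n)$ and $g\in C^2(\mathbb{T}^n)$ are given. (A1): $\displaystyle\lim_{|p|\to\infty}\min_{x\in\mathbb{T}^n}\Big(\tfrac12 H(x,p)^2+D_xH(x,p)\cdot p\Big)=+\infty.$ (A2): there exists $\theta>0$ such that $D_pH(x,p)\cdot p\ge(\theta+1)H(x,p)$ for all $(x,p)\in\mathbb{T}^n\times\mathbb{R}^n$. $\overline H(0)$ is the unique real constant for which $H(x,Dv_0(x))=\overline H(0)$ in $\mathbb{T}^n$ has a viscosity solution $v_0\in C(\mathbb{T}^n)$. $\operatorname{Lip}(\mathbb{T}^n)$ is the set of Lipschitz functions on $\mathbb{T}^n$. *)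

theory Defs
  imports "HOL-Analysis.Analysis" "HOL-Probability.Essential_Supremum"
begin

text \<open>
  Functions on the torus \<open>\<T>\<^sup>n = \<real>\<^sup>n / \<int>\<^sup>n\<close> are represented by their lifts, i.e. by the
  \<open>\<int>\<^sup>n\<close>-periodic functions on \<^typ>\<open>real ^ 'n\<close>, where \<open>n = CARD('n) \<ge> 1\<close>.
\<close>

definition torus_periodic :: "((real ^ 'n) \<Rightarrow> 'b) \<Rightarrow> bool" where
  "torus_periodic f \<longleftrightarrow> (\<forall>x k. (\<forall>i. k $ i \<in> \<int>) \<longrightarrow> f (x + k) = f x)"

text \<open>\<open>C\<^sup>1\<close> and \<open>C\<^sup>2\<close> regularity in the Frechet sense; the set \<open>S\<close> is meant to be open.\<close>

definition C1_on :: "'a set \<Rightarrow> ('a::real_normed_vector \<Rightarrow> 'b::real_normed_vector) \<Rightarrow> bool" where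
  "C1_on S f \<longleftrightarrow> (\<exists>f' :: 'a \<Rightarrow> 'a \<Rightarrow>\<^sub>L 'b.
     (\<forall>x\<in>S. (f has_derivative blinfun_apply (f' x)) (at x)) \<and> continuous_on S f')"

definition C2_on :: "'a set \<Rightarrow> ('a::real_normed_vector \<Rightarrow> 'b::real_normed_vector) \<Rightarrow> bool" where
  "C2_on S f \<longleftrightarrow> (\<exists>f' :: 'a \<Rightarrow> 'a \<Rightarrow>\<^sub>L 'b.
     (\<forall>x\<in>S. (f has_derivative blinfun_apply (f' x)) (at x)) \<and> C1_on S f')"

definition gradient :: "('a::real_inner \<Rightarrow> real) \<Rightarrow> 'a \<Rightarrow> 'a" where
  "gradient f x = (THE D. GDERIV f x :> D)"

lemma gradient_eqI:
  assumes "GDERIV f x :> D"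
  shows "gradient f x = D"
proof -
  have "D' = D" if "GDERIV f x :> D'" for D'
  proof -
    have "(\<lambda>h. h \<bullet> D') = (\<lambda>h. h \<bullet> D)"
      using that assms unfolding gderiv_def by (rule has_derivative_unique)
    then show ?thesis
      by (metis inner_commute vector_eq_ldot)
  qed
  then show ?thesis
    unfolding gradient_def using assms by (rule the_equality[rotated])
qed

text \<open>
  Since \<open>H\<close> is periodic and \<open>C\<^sup>2\<close>, the infimum over \<^typ>\<open>real ^ 'n\<close> below is the minimum
  over the torus.
\<close>

definition condition_A1 :: "(real ^ 'n \<Rightarrow> real ^ 'n \<Rightarrow> real) \<Rightarrow> bool" where
  "condition_A1 H \<longleftrightarrow>
     filterlim (\<lambda>p. INF x. 1/2 * (H x p)\<^sup>2 + gradient (\<lambda>y. H y p) x \<bullet> p) at_top at_infinity"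

definition condition_A2 :: "(real ^ 'n \<Rightarrow> real ^ 'n \<Rightarrow> real) \<Rightarrow> bool" where
  "condition_A2 H \<longleftrightarrow>
     (\<exists>\<theta>>0. \<forall>x p. gradient (\<lambda>q. H x q) p \<bullet> p \<ge> (\<theta> + 1) * H x p)"

text \<open>
  Viscosity solutions of \<open>H(x, Dv) = c\<close> on the torus. Being local, the notion is tested with
  \<open>C\<^sup>1\<close> functions on \<^typ>\<open>real ^ 'n\<close> that need not be periodic.
\<close>

definition stationary_subsolution ::
    "(real ^ 'n \<Rightarrow> real ^ 'n \<Rightarrow> real) \<Rightarrow> real \<Rightarrow> (real ^ 'n \<Rightarrow> real) \<Rightarrow> bool" where
  "stationary_subsolution H c v \<longleftrightarrow>
     (\<forall>\<phi> x0. C1_on UNIV \<phi> \<and> (\<forall>\<^sub>F x in nhds x0. v x - \<phi> x \<le> v x0 - \<phi> x0)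
        \<longrightarrow> H x0 (gradient \<phi> x0) \<le> c)"

definition stationary_supersolution ::
    "(real ^ 'n \<Rightarrow> real ^ 'n \<Rightarrow> real) \<Rightarrow> real \<Rightarrow> (real ^ 'n \<Rightarrow> real) \<Rightarrow> bool" where
  "stationary_supersolution H c v \<longleftrightarrow>
     (\<forall>\<phi> x0. C1_on UNIV \<phi> \<and> (\<forall>\<^sub>F x in nhds x0. v x - \<phi> x \<ge> v x0 - \<phi> x0)
        \<longrightarrow> H x0 (gradient \<phi> x0) \<ge> c)"

definition stationary_viscosity_solution ::
    "(real ^ 'n \<Rightarrow> real ^ 'n \<Rightarrow> real) \<Rightarrow> real \<Rightarrow> (real ^ 'n \<Rightarrow> real) \<Rightarrow> bool" where
  "stationary_viscosity_solution H c v \<longleftrightarrow>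
     continuous_on UNIV v \<and> torus_periodic v \<and>
     stationary_subsolution H c v \<and> stationary_supersolution H c v"

text \<open>
  \<open>c\<close> is the effective Hamiltonian of \<open>H\<close> at \<open>0\<close>: the unique constant for which
  \<open>H(x, Dv) = c\<close> has a continuous viscosity solution on the torus.
\<close>

definition is_effective_Hamiltonian_at_0 ::
    "(real ^ 'n \<Rightarrow> real ^ 'n \<Rightarrow> real) \<Rightarrow> real \<Rightarrow> bool" where
  "is_effective_Hamiltonian_at_0 H c \<longleftrightarrow>
     (\<exists>v. stationary_viscosity_solution H c v) \<and>
     (\<forall>c'. (\<exists>v. stationary_viscosity_solution H c' v) \<longrightarrow> c' = c)"

text \<open>
  Viscosity solutions of \<open>u\<^sub>t + H(x, Du) = 0\<close> on the torus times \<open>(0, \<infinity>)\<close> with initial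
  datum \<open>g\<close>. Values of \<open>u\<close> at negative times are irrelevant.
\<close>

definition evolution_subsolution ::
    "(real ^ 'n \<Rightarrow> real ^ 'n \<Rightarrow> real) \<Rightarrow> (real ^ 'n \<Rightarrow> real \<Rightarrow> real) \<Rightarrow> bool" where
  "evolution_subsolution H u \<longleftrightarrow>
     (\<forall>(\<phi> :: (real ^ 'n) \<times> real \<Rightarrow> real) x0 t0.
        t0 > 0 \<and> C1_on (UNIV \<times> {0<..}) \<phi> \<and>
        (\<forall>\<^sub>F (x, t) in nhds (x0, t0). u x t - \<phi> (x, t) \<le> u x0 t0 - \<phi> (x0, t0))
        \<longrightarrow> deriv (\<lambda>t. \<phi> (x0, t)) t0 + H x0 (gradient (\<lambda>x. \<phi> (x, t0)) x0) \<le> 0)"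

definition evolution_supersolution ::
    "(real ^ 'n \<Rightarrow> real ^ 'n \<Rightarrow> real) \<Rightarrow> (real ^ 'n \<Rightarrow> real \<Rightarrow> real) \<Rightarrow> bool" where
  "evolution_supersolution H u \<longleftrightarrow>
     (\<forall>(\<phi> :: (real ^ 'n) \<times> real \<Rightarrow> real) x0 t0.
        t0 > 0 \<and> C1_on (UNIV \<times> {0<..}) \<phi> \<and>
        (\<forall>\<^sub>F (x, t) in nhds (x0, t0). u x t - \<phi> (x, t) \<ge> u x0 t0 - \<phi> (x0, t0))
        \<longrightarrow> deriv (\<lambda>t. \<phi> (x0, t)) t0 + H x0 (gradient (\<lambda>x. \<phi> (x, t0)) x0) \<ge> 0)"

definition Cauchy_viscosity_solution ::
    "(real ^ 'n \<Rightarrow> real ^ 'n \<Rightarrow> real) \<Rightarrow> (real ^ 'n \<Rightarrow> real) \<Rightarrow>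
     (real ^ 'n \<Rightarrow> real \<Rightarrow> real) \<Rightarrow> bool" where
  "Cauchy_viscosity_solution H g u \<longleftrightarrow>
     continuous_on (UNIV \<times> {0..}) (\<lambda>(x, t). u x t) \<and>
     (\<forall>t\<ge>0. torus_periodic (\<lambda>x. u x t)) \<and>
     evolution_subsolution H u \<and> evolution_supersolution H u \<and>
     (\<forall>x. u x 0 = g x)"

text \<open>
  The \<open>L\<^sup>\<infinity>\<close> norm over the torus of a periodic function, which is the essential supremum of
  its absolute value over the whole of \<^typ>\<open>real ^ 'n\<close>.
\<close>

definition Linfty_norm :: "(real ^ 'n \<Rightarrow> real) \<Rightarrow> ereal" where
  "Linfty_norm f = esssup lborel (\<lambda>x. ereal \<bar>f x\<bar>)"

end

theory Submission
  imports Defs "HOL-Analysis.Kronecker_Approximation_Theorem" "HOL-Complex_Analysis.Great_Picard"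
begin

text \<open>
  The proof rests on a one-sided scaling symmetry. By (A2), \<open>s \<mapsto> s powr - (\<theta> + 1) * H x (s p)\<close> is
  nondecreasing, so for \<open>l \<ge> 1\<close> the function \<open>(x, t) \<mapsto> l * u x (l powr \<theta> * t)\<close> is a supersolution
  (\<open>space_time_super_dilate\<close>). Its initial values differ from those of \<open>u\<close> by \<open>O(l - 1)\<close>, and
  comparison with \<open>u\<close> gives, with \<open>l powr \<theta> = 1 + h / t\<close>,
  \<open>u x (t + h) \<ge> u x t - C * ((1 + h / t) powr (1 / \<theta>) - 1)\<close>: for fixed \<open>h\<close> the solution is
  nondecreasing up to an error that vanishes as \<open>t \<rightarrow> \<infinity>\<close> (\<open>almost_increasing\<close>).

  Over successive unit time steps these errors are of order \<open>1 / t\<close> and need not sum up, so the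
  monotonicity is exploited only in a limit. The functions \<open>u(\<cdot>, t)\<close> are uniformly bounded, by
  comparison with a stationary solution (this is where the vanishing of the effective Hamiltonian
  enters), and uniformly Lipschitz. Hence \<open>u(\<cdot>, k\<^sub>n)\<close> converges uniformly along a sequence of
  times, and since the flow is a contraction in the supremum norm,
  \<open>u(\<cdot>, t + k\<^sub>n)\<close> converges uniformly in \<open>t \<ge> 0\<close> as well, to some \<open>U(\<cdot>, t)\<close>. This \<open>U\<close> is truly
  nondecreasing in \<open>t\<close>, so it increases to a limit \<open>v\<close>, uniformly in space. Uniformity in \<open>t\<close>
  of the first limit shows that \<open>u\<close> itself tends to \<open>v\<close>
  (\<open>bounded_lipschitz_solution_converges\<close>), and \<open>v\<close> is a stationary solution because it is a
  uniform limit of the time translates of \<open>u\<close> (\<open>space_time_sub_limit\<close>).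

  Comparison and compactness come from two further observations. First, (A1) forces
  \<open>\<bar>H x p\<bar> \<rightarrow> \<infinity>\<close> as \<open>\<bar>p\<bar> \<rightarrow> \<infinity>\<close>, with a sign depending on \<open>p\<close> but not on \<open>x\<close>
  (\<open>A1_sign_coercive\<close>); the sign may be negative, as for \<open>H x p = - \<bar>p\<bar>\<^sup>2\<close>, and in one dimension it may
  differ between the two directions, as for \<open>H x p = p\<^sup>3\<close>. Secondly, when variables are
  doubled, subsolution and supersolution are tested with the same momentum \<open>p\<close>, at two points of
  space. Bounds \<open>H x p \<le> C\<close> and \<open>H y p \<ge> - C\<close> therefore bound \<open>p\<close> whatever the sign is. This
  single observation gives both the comparison principle for merely continuous solutions and the
  uniform Lipschitz estimate.
\<close>

section \<open>Test functions on the whole of space-time\<close>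

lemma C1_on_iff_continuous_gradient:
  fixes f :: "'a::euclidean_space \<Rightarrow> real"
  shows "C1_on S f \<longleftrightarrow> (\<exists>G. (\<forall>x\<in>S. GDERIV f x :> G x) \<and> continuous_on S G)"
proof
  assume "C1_on S f"
  then obtain f' :: "'a \<Rightarrow> 'a \<Rightarrow>\<^sub>L real"
    where f': "\<forall>x\<in>S. (f has_derivative blinfun_apply (f' x)) (at x)" "continuous_on S f'"
    unfolding C1_on_def by blast
  (* The Riesz representative of the derivative. *)
  define G where "G x = (\<Sum>b\<in>Basis. f' x b *\<^sub>R b)" for x
  have G: "h \<bullet> G x = f' x h" for x h
  proof -
    have "f' x h = f' x (\<Sum>b\<in>Basis. (h \<bullet> b) *\<^sub>R b)"
      by (simp add: euclidean_representation)
    also have "\<dots> = (\<Sum>b\<in>Basis. (h \<bullet> b) * f' x b)"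
      by (simp add: blinfun.sum_right blinfun.scaleR_right)
    finally show ?thesis
      by (simp add: G_def inner_sum_right mult.commute)
  qed
  have "GDERIV f x :> G x" if "x \<in> S" for x
    using f'(1) that by (simp add: gderiv_def G)
  moreover have "continuous_on S G"
    unfolding G_def by (intro continuous_intros f'(2))
  ultimately show "\<exists>G. (\<forall>x\<in>S. GDERIV f x :> G x) \<and> continuous_on S G"
    by blast
next
  assume "\<exists>G. (\<forall>x\<in>S. GDERIV f x :> G x) \<and> continuous_on S G"
  then obtain G where G: "\<forall>x\<in>S. GDERIV f x :> G x" "continuous_on S G"
    by blast
  show "C1_on S f"
    unfolding C1_on_def
  proof (intro exI conjI ballI)
    show "(f has_derivative blinfun_apply (blinfun_inner_left (G x))) (at x)" if "x \<in> S" for x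
      using G(1) that by (simp add: gderiv_def)
    show "continuous_on S (\<lambda>x. blinfun_inner_left (G x))"
      by (intro bounded_linear.continuous_on[OF bounded_linear_blinfun_inner_left] G(2))
  qed
qed

lemma C2_imp_C1:
  assumes "C2_on S f"
  shows "C1_on S f"
proof -
  obtain f' where f': "\<forall>x\<in>S. (f has_derivative blinfun_apply (f' x)) (at x)" "C1_on S f'"
    using assms unfolding C2_on_def by blast
  have "continuous_on S f'"
  proof -
    obtain f2 where "\<forall>x\<in>S. (f' has_derivative blinfun_apply (f2 x)) (at x)"
      using f'(2) unfolding C1_on_def by blast
    then show ?thesis
      by (blast intro: continuous_at_imp_continuous_on has_derivative_continuous)
  qed
  with f'(1) show ?thesis
    unfolding C1_on_def by blast
qed

lemma GDERIV_fst_slice: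
  fixes \<phi> :: "'a::real_inner \<times> 'b::real_inner \<Rightarrow> real"
  assumes "GDERIV \<phi> (x, t) :> D"
  shows "GDERIV (\<lambda>x. \<phi> (x, t)) x :> fst D"
proof -
  have "((\<lambda>x. (x, t)) has_derivative (\<lambda>h. (h, 0))) (at x)"
    by (auto intro!: derivative_eq_intros)
  from has_derivative_compose[OF this assms[unfolded gderiv_def]] show ?thesis
    by (simp add: gderiv_def inner_prod_def)
qed

lemma GDERIV_snd_slice:
  fixes \<phi> :: "'a::real_inner \<times> 'b::real_inner \<Rightarrow> real"
  assumes "GDERIV \<phi> (x, t) :> D"
  shows "GDERIV (\<lambda>t. \<phi> (x, t)) t :> snd D"
proof -
  have "((\<lambda>t. (x, t)) has_derivative (\<lambda>h. (0, h))) (at t)"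
    by (auto intro!: derivative_eq_intros)
  from has_derivative_compose[OF this assms[unfolded gderiv_def]] show ?thesis
    by (simp add: gderiv_def inner_prod_def)
qed

text \<open>
  The viscosity inequalities are used only for test functions that are \<open>C\<^sup>1\<close> on all of
  space-time, together with their gradient. Unlike the functions that are \<open>C\<^sup>1\<close> for positive times
  only, this class is invariant under translations in time, so that time translates of
  solutions are again solutions without any extension of test functions. It contains the
  penalties of the doubling argument and the time-independent test functions.
\<close>

definition entire_test :: "('a::euclidean_space \<Rightarrow> real) \<Rightarrow> ('a \<Rightarrow> 'a) \<Rightarrow> bool" where
  "entire_test \<phi> G \<longleftrightarrow> continuous_on UNIV G \<and> (\<forall>z. GDERIV \<phi> z :> G z)"

definition space_time_sub :: "(real ^ 'n \<Rightarrow> real ^ 'n \<Rightarrow> real) \<Rightarrow> (real ^ 'n \<Rightarrow> real \<Rightarrow> real) \<Rightarrow> bool" where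
  "space_time_sub H u \<longleftrightarrow>
     (\<forall>\<phi> G x0 t0. entire_test \<phi> G \<longrightarrow> t0 > 0 \<longrightarrow>
        (\<forall>\<^sub>F z in nhds (x0, t0). u (fst z) (snd z) - \<phi> z \<le> u x0 t0 - \<phi> (x0, t0)) \<longrightarrow>
        snd (G (x0, t0)) + H x0 (fst (G (x0, t0))) \<le> 0)"

definition space_time_super :: "(real ^ 'n \<Rightarrow> real ^ 'n \<Rightarrow> real) \<Rightarrow> (real ^ 'n \<Rightarrow> real \<Rightarrow> real) \<Rightarrow> bool" where
  "space_time_super H u \<longleftrightarrow>
     (\<forall>\<phi> G x0 t0. entire_test \<phi> G \<longrightarrow> t0 > 0 \<longrightarrow>
        (\<forall>\<^sub>F z in nhds (x0, t0). u (fst z) (snd z) - \<phi> z \<ge> u x0 t0 - \<phi> (x0, t0)) \<longrightarrow>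
        snd (G (x0, t0)) + H x0 (fst (G (x0, t0))) \<ge> 0)"

lemma entire_test_uminus: "entire_test \<phi> G \<Longrightarrow> entire_test (\<lambda>z. - \<phi> z) (\<lambda>z. - G z)"
  unfolding entire_test_def by (auto intro!: continuous_intros GDERIV_minus)

text \<open>
  Every statement about supersolutions follows from the one about subsolutions through
  \<open>u \<mapsto> - u\<close> and \<open>H x p \<mapsto> - H x (- p)\<close>.
\<close>

lemma space_time_super_iff_sub:
  "space_time_super H u \<longleftrightarrow> space_time_sub (\<lambda>x p. - H x (- p)) (\<lambda>x t. - u x t)"
proof
  assume *: "space_time_super H u"
  show "space_time_sub (\<lambda>x p. - H x (- p)) (\<lambda>x t. - u x t)"
    unfolding space_time_sub_def
  proof (intro allI impI)
    fix \<phi> G x0 and t0 :: real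
    assume **: "entire_test \<phi> G" "0 < t0"
      "\<forall>\<^sub>F z in nhds (x0, t0). - u (fst z) (snd z) - \<phi> z \<le> - u x0 t0 - \<phi> (x0, t0)"
    have "\<forall>\<^sub>F z in nhds (x0, t0). u (fst z) (snd z) - (- \<phi> z) \<ge> u x0 t0 - (- \<phi> (x0, t0))"
      using **(3) by eventually_elim simp
    from *[unfolded space_time_super_def, rule_format, OF entire_test_uminus[OF **(1)] **(2) this]
    show "snd (G (x0, t0)) + - H x0 (- fst (G (x0, t0))) \<le> 0"
      by simp
  qed
next
  assume *: "space_time_sub (\<lambda>x p. - H x (- p)) (\<lambda>x t. - u x t)"
  show "space_time_super H u"
    unfolding space_time_super_def
  proof (intro allI impI)
    fix \<phi> G x0 and t0 :: real
    assume **: "entire_test \<phi> G" "0 < t0"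
      "\<forall>\<^sub>F z in nhds (x0, t0). u (fst z) (snd z) - \<phi> z \<ge> u x0 t0 - \<phi> (x0, t0)"
    have "\<forall>\<^sub>F z in nhds (x0, t0). - u (fst z) (snd z) - (- \<phi> z) \<le> - u x0 t0 - (- \<phi> (x0, t0))"
      using **(3) by eventually_elim simp
    from *[unfolded space_time_sub_def, rule_format, OF entire_test_uminus[OF **(1)] **(2) this]
    show "snd (G (x0, t0)) + H x0 (fst (G (x0, t0))) \<ge> 0"
      by simp
  qed
qed

lemma entire_test_imp_C1_on: "entire_test \<phi> G \<Longrightarrow> C1_on S \<phi>"
  unfolding C1_on_iff_continuous_gradient entire_test_def
  by (meson continuous_on_subset subset_UNIV)

lemma entire_test_partials:
  assumes "entire_test \<phi> G"
  shows "deriv (\<lambda>t. \<phi> (x, t)) t = snd (G (x, t))" "gradient (\<lambda>x. \<phi> (x, t)) x = fst (G (x, t))"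
proof -
  have *: "GDERIV \<phi> (x, t) :> G (x, t)"
    using assms by (simp add: entire_test_def)
  show "deriv (\<lambda>t. \<phi> (x, t)) t = snd (G (x, t))"
    using GDERIV_snd_slice[OF *] by (simp add: DERIV_imp_deriv)
  show "gradient (\<lambda>x. \<phi> (x, t)) x = fst (G (x, t))"
    using GDERIV_fst_slice[OF *] by (rule gradient_eqI)
qed

lemma evolution_subsolution_imp_space_time_sub:
  assumes "evolution_subsolution H u"
  shows "space_time_sub H u"
  unfolding space_time_sub_def
proof (intro allI impI)
  fix \<phi> G x0 and t0 :: real
  assume *: "entire_test \<phi> G" "0 < t0"
    "\<forall>\<^sub>F z in nhds (x0, t0). u (fst z) (snd z) - \<phi> z \<le> u x0 t0 - \<phi> (x0, t0)"
  have "\<forall>\<^sub>F (x, t) in nhds (x0, t0). u x t - \<phi> (x, t) \<le> u x0 t0 - \<phi> (x0, t0)"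
    using *(3) by (simp add: case_prod_unfold)
  then have "deriv (\<lambda>t. \<phi> (x0, t)) t0 + H x0 (gradient (\<lambda>x. \<phi> (x, t0)) x0) \<le> 0"
    using assms[unfolded evolution_subsolution_def] entire_test_imp_C1_on[OF *(1)] *(2) by blast
  then show "snd (G (x0, t0)) + H x0 (fst (G (x0, t0))) \<le> 0"
    by (simp add: entire_test_partials[OF *(1)])
qed

lemma evolution_supersolution_imp_space_time_super:
  assumes "evolution_supersolution H u"
  shows "space_time_super H u"
  unfolding space_time_super_def
proof (intro allI impI)
  fix \<phi> G x0 and t0 :: real
  assume *: "entire_test \<phi> G" "0 < t0"
    "\<forall>\<^sub>F z in nhds (x0, t0). u (fst z) (snd z) - \<phi> z \<ge> u x0 t0 - \<phi> (x0, t0)"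
  have "\<forall>\<^sub>F (x, t) in nhds (x0, t0). u x t - \<phi> (x, t) \<ge> u x0 t0 - \<phi> (x0, t0)"
    using *(3) by (simp add: case_prod_unfold)
  then have "deriv (\<lambda>t. \<phi> (x0, t)) t0 + H x0 (gradient (\<lambda>x. \<phi> (x, t0)) x0) \<ge> 0"
    using assms[unfolded evolution_supersolution_def] entire_test_imp_C1_on[OF *(1)] *(2) by blast
  then show "snd (G (x0, t0)) + H x0 (fst (G (x0, t0))) \<ge> 0"
    by (simp add: entire_test_partials[OF *(1)])
qed

text \<open>
  A test function touching the time-independent \<open>v\<close> from above has an extremum in time at the
  contact point, so its time derivative vanishes there.
\<close>

lemma stationary_imp_space_time_sub:
  assumes "stationary_subsolution H 0 v"
  shows "space_time_sub H (\<lambda>x t. v x)"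
  unfolding space_time_sub_def
proof (intro allI impI)
  fix \<phi> G x0 and t0 :: real
  assume *: "entire_test \<phi> G" "0 < t0"
    "\<forall>\<^sub>F z in nhds (x0, t0). v (fst z) - \<phi> z \<le> v x0 - \<phi> (x0, t0)"
  have GD: "GDERIV \<phi> (x, t) :> G (x, t)" for x t
    using *(1) by (simp add: entire_test_def)
  have "entire_test (\<lambda>x. \<phi> (x, t0)) (\<lambda>x. fst (G (x, t0)))"
    unfolding entire_test_def
  proof (intro conjI allI)
    have "continuous_on UNIV (\<lambda>x. G (x, t0))"
      using *(1) unfolding entire_test_def
      by (intro continuous_on_compose2[of UNIV G UNIV "\<lambda>x. (x, t0)"] continuous_intros) auto
    then show "continuous_on UNIV (\<lambda>x. fst (G (x, t0)))"
      by (rule continuous_on_fst)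
    show "GDERIV (\<lambda>x. \<phi> (x, t0)) x :> fst (G (x, t0))" for x
      by (rule GDERIV_fst_slice[OF GD])
  qed
  moreover have "\<forall>\<^sub>F x in nhds x0. v x - \<phi> (x, t0) \<le> v x0 - \<phi> (x0, t0)"
  proof -
    have "filterlim (\<lambda>x. (x, t0)) (nhds (x0, t0)) (nhds x0)"
      by (intro tendsto_intros filterlim_ident)
    from eventually_compose_filterlim[OF *(3) this] show ?thesis
      by simp
  qed
  ultimately have "H x0 (gradient (\<lambda>x. \<phi> (x, t0)) x0) \<le> 0"
    using assms unfolding stationary_subsolution_def by (blast dest: entire_test_imp_C1_on)
  moreover have "snd (G (x0, t0)) = 0"
  proof -
    have "filterlim (\<lambda>t. (x0, t)) (nhds (x0, t0)) (nhds t0)"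
      by (intro tendsto_intros filterlim_ident)
    from eventually_compose_filterlim[OF *(3) this]
    have "\<forall>\<^sub>F t in nhds t0. \<phi> (x0, t0) \<le> \<phi> (x0, t)"
      by simp
    then obtain d where d: "d > 0" "\<forall>t. dist t t0 < d \<longrightarrow> \<phi> (x0, t0) \<le> \<phi> (x0, t)"
      by (auto simp: eventually_nhds_metric)
    have "DERIV (\<lambda>t. \<phi> (x0, t)) t0 :> snd (G (x0, t0))"
      using GDERIV_snd_slice[OF GD] by simp
    from DERIV_local_min[OF this d(1)] d(2) show ?thesis
      by (simp add: dist_real_def abs_minus_commute)
  qed
  ultimately show "snd (G (x0, t0)) + H x0 (fst (G (x0, t0))) \<le> 0"
    by (simp add: entire_test_partials[OF *(1)])
qed

lemma stationary_supersolution_iff_sub: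
  fixes v :: "real ^ 'n \<Rightarrow> real"
  shows "stationary_supersolution H 0 v \<longleftrightarrow> stationary_subsolution (\<lambda>x p. - H x (- p)) 0 (\<lambda>x. - v x)"
proof -
  have neg: "C1_on UNIV (\<lambda>x. - \<phi> x)" "gradient (\<lambda>x. - \<phi> x) x = - gradient \<phi> x"
    if "C1_on UNIV \<phi>" for \<phi> :: "real ^ 'n \<Rightarrow> real" and x
  proof -
    obtain G where "entire_test \<phi> G"
      using \<open>C1_on UNIV \<phi>\<close> unfolding C1_on_iff_continuous_gradient entire_test_def by blast
    then have G: "entire_test (\<lambda>x. - \<phi> x) (\<lambda>x. - G x)" "GDERIV \<phi> x :> G x"
      using entire_test_uminus by (auto simp: entire_test_def)
    show "C1_on UNIV (\<lambda>x. - \<phi> x)"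
      by (rule entire_test_imp_C1_on[OF G(1)])
    show "gradient (\<lambda>x. - \<phi> x) x = - gradient \<phi> x"
      using gradient_eqI[OF G(2)] gradient_eqI[OF GDERIV_minus[OF G(2)]] by simp
  qed
  show ?thesis
  proof
    assume *: "stationary_supersolution H 0 v"
    show "stationary_subsolution (\<lambda>x p. - H x (- p)) 0 (\<lambda>x. - v x)"
      unfolding stationary_subsolution_def
    proof (intro allI impI, elim conjE)
      fix \<phi> x0
      assume **: "C1_on UNIV \<phi>" "\<forall>\<^sub>F x in nhds x0. - v x - \<phi> x \<le> - v x0 - \<phi> x0"
      have "\<forall>\<^sub>F x in nhds x0. v x - (- \<phi> x) \<ge> v x0 - (- \<phi> x0)"
        using **(2) by eventually_elim simp
      from *[unfolded stationary_supersolution_def, rule_format, OF conjI, OF neg(1)[OF **(1)] this]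
      show "- H x0 (- gradient \<phi> x0) \<le> 0"
        by (simp add: neg(2)[OF **(1)])
    qed
  next
    assume *: "stationary_subsolution (\<lambda>x p. - H x (- p)) 0 (\<lambda>x. - v x)"
    show "stationary_supersolution H 0 v"
      unfolding stationary_supersolution_def
    proof (intro allI impI, elim conjE)
      fix \<phi> x0
      assume **: "C1_on UNIV \<phi>" "\<forall>\<^sub>F x in nhds x0. v x - \<phi> x \<ge> v x0 - \<phi> x0"
      have "\<forall>\<^sub>F x in nhds x0. - v x - (- \<phi> x) \<le> - v x0 - (- \<phi> x0)"
        using **(2) by eventually_elim simp
      from *[unfolded stationary_subsolution_def, rule_format, OF conjI, OF neg(1)[OF **(1)] this]
      show "H x0 (gradient \<phi> x0) \<ge> 0"
        by (simp add: neg(2)[OF **(1)])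
    qed
  qed
qed

lemma space_time_sub_imp_stationary:
  fixes v :: "real ^ 'n \<Rightarrow> real"
  assumes "space_time_sub H (\<lambda>x t. v x)"
  shows "stationary_subsolution H 0 v"
  unfolding stationary_subsolution_def
proof (intro allI impI, elim conjE)
  fix \<phi> x0
  assume *: "C1_on UNIV \<phi>" "\<forall>\<^sub>F x in nhds x0. v x - \<phi> x \<le> v x0 - \<phi> x0"
  obtain G where G: "\<And>x. GDERIV \<phi> x :> G x" "continuous_on UNIV G"
    using *(1) unfolding C1_on_iff_continuous_gradient by blast
  have "entire_test (\<lambda>z. \<phi> (fst z)) (\<lambda>z::(real^'n) \<times> real. (G (fst z), 0))"
    unfolding entire_test_def
  proof (intro conjI allI)
    show "continuous_on UNIV (\<lambda>z::(real^'n) \<times> real. (G (fst z), 0::real))"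
      by (intro continuous_intros continuous_on_compose2[OF G(2)]) auto
    fix z :: "(real^'n) \<times> real"
    have "((\<lambda>z. \<phi> (fst z)) has_derivative (\<lambda>h. fst h \<bullet> G (fst z))) (at z)"
      using has_derivative_compose[OF has_derivative_fst[OF has_derivative_ident]
          G(1)[unfolded gderiv_def]] .
    then show "GDERIV (\<lambda>z. \<phi> (fst z)) z :> (G (fst z), 0)"
      by (simp add: gderiv_def inner_prod_def)
  qed
  moreover have "\<forall>\<^sub>F z in nhds (x0, 1::real). v (fst z) - \<phi> (fst z) \<le> v x0 - \<phi> x0"
  proof -
    have "filterlim fst (nhds x0) (nhds (x0, 1::real))"
      using tendsto_fst[OF filterlim_ident[of "nhds (x0, 1::real)"]] by simp
    from eventually_compose_filterlim[OF *(2) this] show ?thesis by simp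
  qed
  ultimately have "H x0 (G x0) \<le> 0"
    using assms[unfolded space_time_sub_def, rule_format,
        of "\<lambda>z. \<phi> (fst z)" "\<lambda>z. (G (fst z), 0)" 1 x0] by simp
  then show "H x0 (gradient \<phi> x0) \<le> 0"
    by (simp add: gradient_eqI[OF G(1)])
qed

lemma space_time_sub_iff_stationary:
  "space_time_sub H (\<lambda>x t. v x) \<longleftrightarrow> stationary_subsolution H 0 v"
  using stationary_imp_space_time_sub space_time_sub_imp_stationary by blast

lemma space_time_super_iff_stationary:
  "space_time_super H (\<lambda>x t. v x) \<longleftrightarrow> stationary_supersolution H 0 v"
  unfolding space_time_super_iff_sub stationary_supersolution_iff_sub
  by (rule space_time_sub_iff_stationary)

section \<open>Continuous functions on the torus\<close>

lemma integer_translate_in_unit_cube: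
  fixes x :: "real ^ 'n"
  obtains k :: "real ^ 'n" where "\<And>i. k $ i \<in> \<int>" "x + k \<in> cbox 0 1"
proof
  show "(\<chi> i. - of_int \<lfloor>x $ i\<rfloor> :: real ^ 'n) $ i \<in> \<int>" for i
    by simp
  have "0 \<le> x $ i - of_int \<lfloor>x $ i\<rfloor>" "x $ i - of_int \<lfloor>x $ i\<rfloor> \<le> 1" for i
    by linarith+
  then show "x + (\<chi> i. - of_int \<lfloor>x $ i\<rfloor>) \<in> cbox 0 1"
    by (simp add: mem_box_cart)
qed

lemma unit_cube_norm_bound:
  obtains r where "r > 0" "\<And>x :: real ^ 'n. x \<in> cbox 0 1 \<Longrightarrow> norm x \<le> r"
  using bounded_cbox[of "0 :: real ^ 'n" 1] unfolding bounded_pos by blast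

text \<open>
  The parameter \<open>s\<close> stands for time in the bounds on solutions; in
  \<open>periodic_uniformly_continuous\<close> it is either time or the momentum argument of \<open>H\<close>.
\<close>

lemma periodic_bounded:
  fixes F :: "real ^ 'n \<Rightarrow> 'b::metric_space \<Rightarrow> real"
  assumes "compact K" "continuous_on (UNIV \<times> K) (\<lambda>(x, s). F x s)"
    and "\<And>s. s \<in> K \<Longrightarrow> torus_periodic (\<lambda>x. F x s)"
  obtains B where "B > 0" "\<And>x s. s \<in> K \<Longrightarrow> \<bar>F x s\<bar> \<le> B"
proof -
  have "compact ((\<lambda>(x, s). F x s) ` (cbox 0 1 \<times> K))"
    by (intro compact_continuous_image continuous_on_subset[OF assms(2)] compact_Times assms(1)) auto
  then obtain B where B: "B > 0" "\<And>y. y \<in> (\<lambda>(x, s). F x s) ` (cbox 0 1 \<times> K) \<Longrightarrow> norm y \<le> B"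
    using compact_imp_bounded[of "(\<lambda>(x, s). F x s) ` (cbox 0 1 \<times> K)"] unfolding bounded_pos by blast
  have "\<bar>F x s\<bar> \<le> B" if "s \<in> K" for x s
  proof -
    obtain k :: "real ^ 'n" where k: "\<And>i. k $ i \<in> \<int>" "x + k \<in> cbox 0 1"
      using integer_translate_in_unit_cube[of x] by blast
    have "F (x + k) s = F x s"
      using assms(3)[OF that] k(1) by (simp add: torus_periodic_def)
    then show ?thesis
      using B(2)[OF image_eqI[of _ _ "(x + k, s)"]] k(2) that by simp
  qed
  with B(1) show ?thesis by (rule that)
qed

lemma periodic_bounded_single:
  fixes f :: "real ^ 'n \<Rightarrow> real"
  assumes "continuous_on UNIV f" "torus_periodic f"
  obtains B where "B > 0" "\<And>x. \<bar>f x\<bar> \<le> B"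
proof (rule periodic_bounded[of "{0::real}" "\<lambda>x _. f x"])
  show "continuous_on (UNIV \<times> {0::real}) (\<lambda>(x, s). f x)"
    unfolding case_prod_unfold
    by (intro continuous_on_compose2[OF assms(1) continuous_on_fst[OF continuous_on_id]]) auto
qed (use assms(2) in \<open>auto intro: that\<close>)

lemma gradient_periodic:
  fixes f :: "real ^ 'n \<Rightarrow> real"
  assumes D: "\<And>x. GDERIV f x :> D x" and per: "torus_periodic f"
  shows "torus_periodic D"
  unfolding torus_periodic_def
proof (intro allI impI)
  fix x k :: "real ^ 'n" assume k: "\<forall>i. k $ i \<in> \<int>"
  have "((\<lambda>y. f (y + k)) has_derivative (\<lambda>h. h \<bullet> D (x + k))) (at x)"
    by (rule has_derivative_compose[of "\<lambda>y. y + k", OF _ D[unfolded gderiv_def]])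
      (auto intro!: derivative_eq_intros)
  moreover have "(\<lambda>y. f (y + k)) = f"
    using per k by (simp add: torus_periodic_def)
  ultimately have "GDERIV f x :> D (x + k)"
    by (simp add: gderiv_def)
  then show "D (x + k) = D x"
    using gradient_eqI[OF D, of x] gradient_eqI by metis
qed

lemma periodic_uniformly_continuous:
  fixes F :: "real ^ 'n \<Rightarrow> 'b::metric_space \<Rightarrow> real"
  assumes "compact K" "continuous_on (UNIV \<times> K) (\<lambda>(x, s). F x s)"
    and "\<And>s. s \<in> K \<Longrightarrow> torus_periodic (\<lambda>x. F x s)" and "e > 0"
  obtains d where "d > 0"
    "\<And>x y s s'. s \<in> K \<Longrightarrow> s' \<in> K \<Longrightarrow> norm (x - y) < d \<Longrightarrow> dist s s' < d \<Longrightarrow> \<bar>F x s - F y s'\<bar> < e"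
proof -
  obtain r where r: "r > 0" "\<And>x :: real ^ 'n. x \<in> cbox 0 1 \<Longrightarrow> norm x \<le> r"
    by (rule unit_cube_norm_bound) blast
  have "uniformly_continuous_on (cball 0 (r + 1) \<times> K) (\<lambda>(x, s). F x s)"
    by (intro compact_uniformly_continuous continuous_on_subset[OF assms(2)] compact_Times assms(1)) auto
  then obtain d where d: "d > 0" "\<And>z z'. z \<in> cball 0 (r + 1) \<times> K \<Longrightarrow> z' \<in> cball 0 (r + 1) \<times> K \<Longrightarrow>
      dist z' z < d \<Longrightarrow> dist ((\<lambda>(x, s). F x s) z') ((\<lambda>(x, s). F x s) z) < e"
    unfolding uniformly_continuous_on_def using \<open>e > 0\<close> by meson
  show ?thesis
  proof (rule that)
    show "min 1 (d / 2) > 0" using d(1) by simp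
    fix x y :: "real ^ 'n" and s s'
    assume *: "s \<in> K" "s' \<in> K" "norm (x - y) < min 1 (d / 2)" "dist s s' < min 1 (d / 2)"
    obtain k :: "real ^ 'n" where k: "\<And>i. k $ i \<in> \<int>" "x + k \<in> cbox 0 1"
      using integer_translate_in_unit_cube[of x] by blast
    have P: "F (z + k) t = F z t" if "t \<in> K" for t z
      using assms(3)[OF that] k(1) by (simp add: torus_periodic_def)
    have "norm (x + k) \<le> r"
      using r(2) k(2) by blast
    moreover have "norm (y + k) \<le> norm (x + k) + norm (x - y)"
      using norm_triangle_ineq4[of "x + k" "x - y"] by (simp add: algebra_simps)
    ultimately have "(x + k, s) \<in> cball 0 (r + 1) \<times> K" "(y + k, s') \<in> cball 0 (r + 1) \<times> K"
      using * by auto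
    moreover have "dist (x + k, s) (y + k, s') < d"
    proof -
      have "dist (x + k, s) (y + k, s') \<le> dist (x + k) (y + k) + dist s s'"
        unfolding dist_Pair_Pair by (rule order_trans[OF sqrt_sum_squares_le_sum_abs]) simp
      also have "dist (x + k) (y + k) = norm (x - y)"
        by (simp add: dist_norm)
      finally show ?thesis
        using * by simp
    qed
    ultimately have "dist (F (x + k) s) (F (y + k) s') < e"
      using d(2)[of "(y + k, s')" "(x + k, s)"] by simp
    then show "\<bar>F x s - F y s'\<bar> < e"
      by (simp add: P * dist_real_def)
  qed
qed

section \<open>Consequences of the growth conditions\<close>

text \<open>
  (A2) says exactly that \<open>s powr - (\<theta> + 1) * H x (s p)\<close> has a nonnegative derivative in \<open>s\<close>.
\<close>

lemma A2_superhomogeneous: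
  fixes H :: "real ^ 'n \<Rightarrow> real ^ 'n \<Rightarrow> real"
  assumes D: "\<And>q. GDERIV (\<lambda>q. H x q) q :> D q"
    and A2: "\<And>q. D q \<bullet> q \<ge> (\<theta> + 1) * H x q" and "l \<ge> 1"
  shows "H x (l *\<^sub>R p) \<ge> l powr (\<theta> + 1) * H x p"
proof -
  define f where "f s = s powr - (\<theta> + 1) * H x (s *\<^sub>R p)" for s
  have "f 1 \<le> f l"
  proof (rule DERIV_nonneg_imp_nondecreasing[OF \<open>l \<ge> 1\<close>])
    fix s :: real assume s: "1 \<le> s" "s \<le> l"
    have "((\<lambda>s. H x (s *\<^sub>R p)) has_derivative (\<lambda>h. (h *\<^sub>R p) \<bullet> D (s *\<^sub>R p))) (at s)"
      by (rule has_derivative_compose[of "\<lambda>s. s *\<^sub>R p", OF _ D[unfolded gderiv_def]])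
        (auto intro!: derivative_eq_intros)
    then have "DERIV (\<lambda>s. H x (s *\<^sub>R p)) s :> D (s *\<^sub>R p) \<bullet> p"
      by (simp add: has_field_derivative_def inner_commute mult_commute_abs)
    then have "DERIV f s :> (- (\<theta> + 1) * s powr (- (\<theta> + 1) - 1)) * H x (s *\<^sub>R p)
        + D (s *\<^sub>R p) \<bullet> p * s powr - (\<theta> + 1)"
      unfolding f_def using s by (intro DERIV_mult has_real_derivative_powr) auto
    moreover have "(- (\<theta> + 1) * s powr (- (\<theta> + 1) - 1)) * H x (s *\<^sub>R p)
        + D (s *\<^sub>R p) \<bullet> p * s powr - (\<theta> + 1)
        = s powr (- (\<theta> + 1) - 1) * (D (s *\<^sub>R p) \<bullet> (s *\<^sub>R p) - (\<theta> + 1) * H x (s *\<^sub>R p))"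
    proof -
      have "s powr - (\<theta> + 1) = s powr (- (\<theta> + 1) - 1) * s"
        using s powr_mult_base[of s "- (\<theta> + 1) - 1"] by (simp add: algebra_simps)
      then show ?thesis by (simp add: algebra_simps)
    qed
    ultimately show "\<exists>y. DERIV f s :> y \<and> y \<ge> 0"
      using A2[of "s *\<^sub>R p"] by (metis diff_ge_0_iff_ge mult_nonneg_nonneg powr_ge_zero)
  qed
  then have "H x p \<le> l powr - (\<theta> + 1) * H x (l *\<^sub>R p)"
    by (simp add: f_def)
  then have "l powr (\<theta> + 1) * H x p \<le> l powr (\<theta> + 1) * (l powr - (\<theta> + 1) * H x (l *\<^sub>R p))"
    by (intro mult_left_mono) auto
  also have "\<dots> = H x (l *\<^sub>R p)"
    using \<open>l \<ge> 1\<close> by (simp add: mult.assoc[symmetric] powr_add[symmetric])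
  finally show ?thesis .
qed

text \<open>
  Every linear flow on the torus is recurrent along integer times, by Dirichlet's theorem on
  simultaneous approximation.
\<close>

lemma line_recurrence:
  fixes p :: "real ^ 'n"
  assumes "\<delta> > 0"
  obtains q :: nat and k :: "real ^ 'n" where "q \<ge> 1" "\<And>i. k $ i \<in> \<int>" "norm (real q *\<^sub>R p - k) < \<delta>"
proof -
  define n where "n = CARD('n)"
  obtain \<beta> where \<beta>: "bij_betw \<beta> {0..<n} (UNIV :: 'n set)"
    using ex_bij_betw_nat_finite[of "UNIV :: 'n set"] by (auto simp: n_def)
  obtain N :: nat where N: "real n / \<delta> < real N"
    using reals_Archimedean2 by blast
  have "n > 0" by (simp add: n_def)
  then have "N > 0"
    using N \<open>\<delta> > 0\<close> by (metis divide_pos_pos less_trans of_nat_0_less_iff)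
  obtain q m where q: "0 < q" and m: "\<And>i. i < n \<Longrightarrow> \<bar>of_int q * p $ \<beta> i - of_int (m i)\<bar> < 1 / real N"
    using Dirichlet_approx_simult[OF \<open>N > 0\<close>, of n "\<lambda>i. p $ \<beta> i"] by metis
  define k :: "real ^ 'n" where "k = (\<chi> j. of_int (m (the_inv_into {0..<n} \<beta> j)))"
  have "\<bar>(real (nat q) *\<^sub>R p - k) $ j\<bar> < 1 / real N" for j
  proof -
    have "the_inv_into {0..<n} \<beta> j \<in> {0..<n}" "\<beta> (the_inv_into {0..<n} \<beta> j) = j"
      using \<beta> the_inv_into_into[of \<beta> "{0..<n}" j "{0..<n}"] f_the_inv_into_f[of \<beta> "{0..<n}" j]
      by (auto simp: bij_betw_def)
    then show ?thesis
      using m[of "the_inv_into {0..<n} \<beta> j"] q by (simp add: k_def)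
  qed
  then have "norm (real (nat q) *\<^sub>R p - k) \<le> (\<Sum>j\<in>(UNIV :: 'n set). 1 / real N)"
    by (intro order_trans[OF norm_le_l1_cart] sum_mono less_imp_le)
  also have "\<dots> < \<delta>"
    using N \<open>N > 0\<close> \<open>\<delta> > 0\<close> by (simp add: n_def field_simps)
  finally have "norm (real (nat q) *\<^sub>R p - k) < \<delta>" .
  moreover have "nat q \<ge> 1" "\<And>i. k $ i \<in> \<int>"
    using q by (auto simp: k_def)
  ultimately show ?thesis
    using that by blast
qed

lemma superlevel_forward_invariant:
  fixes f f' :: "real \<Rightarrow> real"
  assumes f: "\<And>s. DERIV f s :> f' s" and up: "\<And>s. f s = c \<Longrightarrow> f' s > 0"
    and "f a \<ge> c" "a \<le> b"
  shows "f b \<ge> c"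
proof (rule ccontr)
  assume "\<not> f b \<ge> c"
  have cont: "continuous_on {a..b} f"
    using f DERIV_isCont continuous_at_imp_continuous_on by blast
  have "compact ({a..b} \<inter> f -` {c..})"
    unfolding compact_eq_bounded_closed
    by (intro conjI continuous_closed_preimage[OF cont] bounded_Int) auto
  moreover have "a \<in> {a..b} \<inter> f -` {c..}"
    using assms by auto
  ultimately obtain t where "t \<in> {a..b} \<inter> f -` {c..}" "\<And>s. s \<in> {a..b} \<inter> f -` {c..} \<Longrightarrow> s \<le> t"
    using compact_attains_sup[of "{a..b} \<inter> f -` {c..}"] by blast
  then have t: "t \<in> {a..b}" "c \<le> f t" "\<And>s. s \<in> {a..b} \<Longrightarrow> c \<le> f s \<Longrightarrow> s \<le> t"
    by auto
  have "t < b"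
    using t \<open>\<not> f b \<ge> c\<close> by (metis atLeastAtMost_iff order.order_iff_strict)
  have "\<exists>d>0. \<forall>h>0. h < d \<longrightarrow> c \<le> f (t + h)"
  proof (cases "f t = c")
    case True
    then show ?thesis
      using DERIV_pos_inc_right[OF f up[OF True]] by (metis less_imp_le)
  next
    case False
    with t(2) have "f t > c" by simp
    then have "\<forall>\<^sub>F s in nhds t. f s > c"
      using DERIV_isCont[OF f, of t] by (simp add: isCont_def order_tendstoD tendsto_at_iff_tendsto_nhds)
    then obtain d where "d > 0" "\<forall>s. dist s t < d \<longrightarrow> f s > c"
      by (auto simp: eventually_nhds_metric)
    then show ?thesis
      by (intro exI[of _ d]) (auto simp: dist_real_def less_imp_le)
  qed
  then obtain d where d: "d > 0" "\<And>h. h > 0 \<Longrightarrow> h < d \<Longrightarrow> c \<le> f (t + h)"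
    by blast
  define h where "h = min (d / 2) (b - t)"
  have "h > 0" "h < d" "t + h \<in> {a..b}"
    using d(1) \<open>t < b\<close> t(1) by (auto simp: h_def)
  with d(2) t(3) show False by fastforce
qed

text \<open>
  A function that increases along the flow of \<open>p\<close> whenever its value lies in \<open>(- C, C)\<close> can never
  return below a level of this band once it has passed it. Recurrence of the flow brings it back,
  so no value lies in the band, and connectedness of space decides the side.
\<close>

lemma torus_avoids_increasing_band:
  fixes h :: "real ^ 'n \<Rightarrow> real"
  assumes h: "\<And>x. GDERIV h x :> D x" and per: "torus_periodic h"
    and up: "\<And>x. \<bar>h x\<bar> < C \<Longrightarrow> D x \<bullet> p > 0" and "C > 0"
  shows "(\<forall>x. h x \<ge> C) \<or> (\<forall>x. h x \<le> - C)"
proof (rule ccontr)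
  assume neg: "\<not> ?thesis"
  have cont: "continuous_on UNIV h"
    using h unfolding gderiv_def
    by (blast intro: continuous_at_imp_continuous_on has_derivative_continuous)
  obtain x0 where x0: "\<bar>h x0\<bar> < C"
  proof -
    obtain x1 x2 where x: "h x1 < C" "h x2 > - C"
      using neg by (auto simp: not_le)
    show ?thesis
    proof (cases "h x1 > - C \<or> h x2 < C")
      case True
      with x that show ?thesis by (metis abs_less_iff minus_less_iff)
    next
      case False
      have "connected (h ` UNIV)"
        by (intro connected_continuous_image cont connected_UNIV)
      moreover have "h x1 \<in> h ` UNIV" "h x2 \<in> h ` UNIV" "h x1 \<le> 0" "0 \<le> h x2"
        using False \<open>C > 0\<close> by auto
      ultimately have "0 \<in> h ` UNIV"
        unfolding connected_iff_interval by blast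
      then obtain x where "h x = 0" by force
      with that[of x] \<open>C > 0\<close> show ?thesis by simp
    qed
  qed
  define f where "f s = h (x0 + s *\<^sub>R p)" for s
  define f' where "f' s = D (x0 + s *\<^sub>R p) \<bullet> p" for s
  have f: "DERIV f s :> f' s" for s
  proof -
    have "((\<lambda>s. h (x0 + s *\<^sub>R p)) has_derivative (\<lambda>t. (t *\<^sub>R p) \<bullet> D (x0 + s *\<^sub>R p))) (at s)"
      by (rule has_derivative_compose[of "\<lambda>s. x0 + s *\<^sub>R p", OF _ h[unfolded gderiv_def]])
        (auto intro!: derivative_eq_intros)
    then show ?thesis
      by (simp add: has_field_derivative_def inner_commute mult_commute_abs f_def[abs_def] f'_def)
  qed
  have up': "f' s > 0" if "\<bar>f s\<bar> < C" for s
    using up that by (simp add: f_def f'_def)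
  have f0: "f 0 = h x0" by (simp add: f_def)
  (* A level of the band above the starting value that is passed before time 1; recurrence
     is available at integer times from 1 on. *)
  obtain s0 where s0: "0 < s0" "s0 < 1" "f 0 < f s0" "f s0 < C"
  proof -
    obtain d1 where d1: "d1 > 0" "\<And>t. t > 0 \<Longrightarrow> t < d1 \<Longrightarrow> f 0 < f (0 + t)"
      using DERIV_pos_inc_right[OF f up', of 0] x0 f0 by metis
    have "f 0 < C" using x0 f0 by simp
    then have "\<forall>\<^sub>F s in nhds 0. f s < C"
      using DERIV_isCont[OF f, of 0] by (simp add: isCont_def order_tendstoD tendsto_at_iff_tendsto_nhds)
    then obtain d2 where d2: "d2 > 0" "\<And>s. dist s 0 < d2 \<Longrightarrow> f s < C"
      by (auto simp: eventually_nhds_metric)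
    define s where "s = min (1 / 2) (min (d1 / 2) (d2 / 2))"
    have "s > 0" "s < 1" "s < d1" "s < d2"
      using d1(1) d2(1) by (auto simp: s_def)
    with d1(2)[of s] d2(2)[of s] that[of s] show ?thesis by simp
  qed
  have above: "f s \<ge> f s0" if "s \<ge> s0" for s
  proof (rule superlevel_forward_invariant[OF f _ order_refl that])
    fix s assume "f s = f s0"
    with s0 x0 f0 show "f' s > 0" by (intro up') auto
  qed
  have "isCont h x0"
    using cont by (simp add: continuous_on_eq_continuous_at)
  then obtain \<delta> where \<delta>: "\<delta> > 0" "\<And>y. norm (y - x0) < \<delta> \<Longrightarrow> norm (h y - h x0) < f s0 - f 0"
    using s0(3) unfolding isCont_def LIM_eq by (metis diff_gt_0_iff_gt diff_self norm_zero)
  obtain q :: nat and k :: "real ^ 'n"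
    where q: "q \<ge> 1" "\<And>i. k $ i \<in> \<int>" "norm (real q *\<^sub>R p - k) < \<delta>"
    using line_recurrence[OF \<delta>(1), of p] by blast
  have "h (x0 + real q *\<^sub>R p) = h (x0 + (real q *\<^sub>R p - k))"
  proof -
    have "h ((x0 + (real q *\<^sub>R p - k)) + k) = h (x0 + (real q *\<^sub>R p - k))"
      using per q(2) unfolding torus_periodic_def by blast
    then show ?thesis by (simp add: algebra_simps)
  qed
  then have "f (real q) < f s0"
    using \<delta>(2)[of "x0 + (real q *\<^sub>R p - k)"] q(3) f0 by (simp add: f_def)
  moreover have "f (real q) \<ge> f s0"
    using q(1) s0(2) by (intro above) linarith
  ultimately show False by simp
qed

text \<open>
  Given \<open>C > 0\<close>, the quantity \<open>1/2 * (H x p)\<^sup>2 + D\<^sub>x H x p \<bullet> p\<close> exceeds \<open>C\<^sup>2 / 2\<close> for large \<open>p\<close>, so its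
  second summand is positive wherever \<open>\<bar>H x p\<bar> < C\<close>: this is the band condition of the preceding lemma for \<open>H(\<cdot>, p)\<close>.
\<close>

lemma A1_sign_coercive:
  fixes H :: "real ^ 'n \<Rightarrow> real ^ 'n \<Rightarrow> real"
  assumes H: "C1_on UNIV (\<lambda>(x, p). H x p)" and per: "\<And>p. torus_periodic (\<lambda>x. H x p)"
    and A1: "condition_A1 H"
  obtains R where "R > 0" "\<And>p. norm p \<ge> R \<Longrightarrow> (\<forall>x. H x p > C) \<or> (\<forall>x. H x p < - C)"
proof -
  define C' where "C' = \<bar>C\<bar> + 1"
  have "C' > 0" by (simp add: C'_def)
  obtain G where G: "\<And>z. GDERIV (\<lambda>(x, p). H x p) z :> G z" "continuous_on UNIV G"
    using H unfolding C1_on_iff_continuous_gradient by auto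
  define D where "D x p = fst (G (x, p))" for x p
  have D: "GDERIV (\<lambda>y. H y p) x :> D x p" for x p
    using GDERIV_fst_slice[OF G(1)[of "(x, p)"]] by (simp add: D_def)
  have contD: "continuous_on UNIV (\<lambda>x. D x p)" for p
    unfolding D_def by (intro continuous_on_fst continuous_on_compose2[OF G(2)] continuous_intros) auto
  have contH: "continuous_on UNIV (\<lambda>x. H x p)" for p
    using D unfolding gderiv_def
    by (blast intro: continuous_at_imp_continuous_on has_derivative_continuous)
  have perD: "torus_periodic (\<lambda>x. D x p)" for p
    by (rule gradient_periodic[OF D per])
  define E where "E x p = 1/2 * (H x p)\<^sup>2 + gradient (\<lambda>y. H y p) x \<bullet> p" for x p
  have E: "E x p = 1/2 * (H x p)\<^sup>2 + D x p \<bullet> p" for x p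
    by (simp add: E_def gradient_eqI[OF D])
  have "filterlim (\<lambda>p. INF x. E x p) at_top at_infinity"
    using A1 by (simp add: condition_A1_def E_def)
  then have "\<forall>\<^sub>F p in at_infinity. (INF x. E x p) \<ge> C'\<^sup>2 / 2"
    unfolding filterlim_at_top by blast
  then obtain R where R: "\<And>p. norm p \<ge> R \<Longrightarrow> (INF x. E x p) \<ge> C'\<^sup>2 / 2"
    by (auto simp: eventually_at_infinity)
  have "(\<forall>x. H x p \<ge> C') \<or> (\<forall>x. H x p \<le> - C')" if "norm p \<ge> R" for p
  proof (rule torus_avoids_increasing_band[OF D per _ \<open>C' > 0\<close>])
    fix x assume "\<bar>H x p\<bar> < C'"
    obtain B where "\<And>x. \<bar>E x p\<bar> \<le> B"
    proof (rule periodic_bounded_single)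
      show "continuous_on UNIV (\<lambda>x. E x p)"
        unfolding E by (intro continuous_intros contD contH)
      show "torus_periodic (\<lambda>x. E x p)"
        unfolding E torus_periodic_def using perD[of p] per[of p] by (simp add: torus_periodic_def)
    qed blast
    then have "bdd_below (range (\<lambda>x. E x p))"
      by (intro bdd_belowI[of _ "- B"]) (auto simp: abs_le_iff minus_le_iff)
    then have "(INF x. E x p) \<le> E x p"
      by (rule cINF_lower) simp
    with R[OF that] have "C'\<^sup>2 / 2 \<le> 1/2 * (H x p)\<^sup>2 + D x p \<bullet> p"
      by (simp add: E)
    moreover have "(H x p)\<^sup>2 < C'\<^sup>2"
      using \<open>\<bar>H x p\<bar> < C'\<close> by (metis abs_ge_zero power2_abs power_strict_mono zero_less_numeral)
    ultimately show "D x p \<bullet> p > 0" by simp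
  qed
  then have *: "(\<forall>x. H x p \<ge> C') \<or> (\<forall>x. H x p \<le> - C')" if "norm p \<ge> R" for p
    using that by blast
  have "C < C'" "- C' < - C"
    by (auto simp: C'_def)
  then have "(\<forall>x. H x p > C) \<or> (\<forall>x. H x p < - C)" if "norm p \<ge> max R 1" for p
    using *[of p] that by (meson less_le_trans le_less_trans max.boundedE)
  then show ?thesis
    by (intro that[of "max R 1"]) auto
qed

section \<open>Doubling the variables\<close>

lemma DERIV_positive_part_squared: "DERIV (\<lambda>t::real. (max 0 t)\<^sup>2) t :> 2 * max 0 t"
proof -
  consider "t > 0" | "t < 0" | "t = 0" by linarith
  then show ?thesis
  proof cases
    case 1
    have "DERIV (\<lambda>t::real. t\<^sup>2) t :> 2 * max 0 t"
      using 1 by (auto intro!: derivative_eq_intros)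
    then show ?thesis
      by (rule has_field_derivative_transform_within_open[of _ _ _ "{0<..}"]) (use 1 in auto)
  next
    case 2
    have "DERIV (\<lambda>t::real. 0) t :> 2 * max 0 t"
      using 2 by (auto intro!: derivative_eq_intros)
    then show ?thesis
      by (rule has_field_derivative_transform_within_open[of _ _ _ "{..<0}"]) (use 2 in auto)
  next
    case 3
    have "(\<lambda>h::real. ((max 0 (0 + h))\<^sup>2 - (max 0 0)\<^sup>2) / h) \<midarrow>0\<rightarrow> 0"
    proof (rule Lim_null_comparison)
      show "\<forall>\<^sub>F h::real in at 0. norm (((max 0 (0 + h))\<^sup>2 - (max 0 0)\<^sup>2) / h) \<le> \<bar>h\<bar>"
        by (auto simp: max_def power2_eq_square abs_mult intro!: always_eventually)
      show "(\<lambda>h::real. \<bar>h\<bar>) \<midarrow>0\<rightarrow> 0"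
        using tendsto_rabs_zero[OF tendsto_ident_at] by blast
    qed
    with 3 show ?thesis by (simp add: DERIV_def)
  qed
qed

lemma entire_test_separated:
  fixes a :: "'a::euclidean_space \<Rightarrow> real" and b :: "real \<Rightarrow> real"
  assumes "entire_test a \<alpha>" and b: "\<And>t. DERIV b t :> \<beta> t" "continuous_on UNIV \<beta>"
  shows "entire_test (\<lambda>z. a (fst z) + b (snd z)) (\<lambda>z. (\<alpha> (fst z), \<beta> (snd z)))"
  unfolding entire_test_def
proof (intro conjI allI)
  have a: "\<And>x. GDERIV a x :> \<alpha> x" "continuous_on UNIV \<alpha>"
    using assms(1) by (auto simp: entire_test_def)
  show "continuous_on UNIV (\<lambda>z::'a \<times> real. (\<alpha> (fst z), \<beta> (snd z)))"
    by (intro continuous_intros continuous_on_compose2[OF a(2)] continuous_on_compose2[OF b(2)]) auto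
  fix z :: "'a \<times> real"
  have "((\<lambda>z. a (fst z)) has_derivative (\<lambda>h. fst h \<bullet> \<alpha> (fst z))) (at z)"
    by (rule has_derivative_compose[OF has_derivative_fst[OF has_derivative_ident] a(1)[unfolded gderiv_def]])
  moreover have "((\<lambda>z. b (snd z)) has_derivative (\<lambda>h. \<beta> (snd z) * snd h)) (at z)"
    by (rule has_derivative_compose[OF has_derivative_snd[OF has_derivative_ident] b(1)[unfolded has_field_derivative_def]])
  ultimately show "GDERIV (\<lambda>z. a (fst z) + b (snd z)) z :> (\<alpha> (fst z), \<beta> (snd z))"
    unfolding gderiv_def by (auto intro!: derivative_eq_intros simp: inner_prod_def mult.commute)
qed

text \<open>
  A \<open>C\<^sup>1\<close> substitute for the norm. Multiplied by \<open>L\<close> it is a penalty whose gradient is bounded by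
  \<open>L\<close> everywhere and has length at least \<open>L / 2\<close> outside the ball of radius \<open>\<mu>\<close>.
\<close>

definition soft_norm :: "real \<Rightarrow> 'a::real_inner \<Rightarrow> real" where
  "soft_norm \<mu> z = sqrt ((norm z)\<^sup>2 + \<mu>\<^sup>2)"

text \<open>
  The gradient of \<open>soft_norm\<close>.
\<close>

definition soft_sgn :: "real \<Rightarrow> 'a::real_inner \<Rightarrow> 'a" where
  "soft_sgn \<mu> z = z /\<^sub>R soft_norm \<mu> z"

context
  fixes \<mu> :: real
  assumes \<mu>: "\<mu> > 0"
begin

lemma soft_norm_pos: "soft_norm \<mu> z > 0"
  using \<mu> by (simp add: soft_norm_def add_nonneg_pos)

lemma norm_le_soft_norm: "norm z \<le> soft_norm \<mu> z"
  by (simp add: soft_norm_def real_le_rsqrt)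

lemma soft_norm_le: "soft_norm \<mu> z \<le> norm z + \<mu>"
  unfolding soft_norm_def using \<mu> sqrt_add_le_add_sqrt[of "(norm z)\<^sup>2" "\<mu>\<^sup>2"] by simp

lemma norm_soft_sgn: "norm (soft_sgn \<mu> z) = norm z / soft_norm \<mu> z"
  using soft_norm_pos[of z] by (simp add: soft_sgn_def divide_inverse mult.commute)

lemma norm_soft_sgn_le: "norm (soft_sgn \<mu> z) \<le> 1"
  using soft_norm_pos[of z] norm_le_soft_norm[of z] by (simp add: norm_soft_sgn)

lemma norm_soft_sgn_ge:
  assumes "norm z \<ge> \<mu>"
  shows "norm (soft_sgn \<mu> z) \<ge> 1 / 2"
  using soft_norm_pos[of z] soft_norm_le[of z] assms by (simp add: norm_soft_sgn field_simps)

lemma soft_norm_zero: "soft_norm \<mu> 0 = \<mu>"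
  using \<mu> by (simp add: soft_norm_def)

lemma soft_norm_test: "entire_test (\<lambda>x. c * soft_norm \<mu> (x - y)) (\<lambda>x. c *\<^sub>R soft_sgn \<mu> (x - y))"
  for y :: "'a::euclidean_space"
  unfolding entire_test_def
proof (intro conjI allI)
  have pos: "soft_norm \<mu> z \<noteq> 0" for z :: 'a
    using soft_norm_pos[of z] by simp
  show "continuous_on UNIV (\<lambda>x. c *\<^sub>R soft_sgn \<mu> (x - y))"
    unfolding soft_sgn_def using pos unfolding soft_norm_def by (intro continuous_intros) auto
  fix x
  have "0 < (norm (x - y))\<^sup>2 + \<mu>\<^sup>2"
    using \<mu> by (simp add: add_nonneg_pos)
  then have "((\<lambda>x. sqrt ((x - y) \<bullet> (x - y) + \<mu>\<^sup>2)) has_derivative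
      (\<lambda>h. (h \<bullet> (x - y)) * inverse (sqrt ((x - y) \<bullet> (x - y) + \<mu>\<^sup>2)))) (at x)"
    by (auto intro!: derivative_eq_intros simp: power2_norm_eq_inner inner_commute field_simps)
  from has_derivative_mult_right[OF this, of c]
  show "GDERIV (\<lambda>x. c * soft_norm \<mu> (x - y)) x :> c *\<^sub>R soft_sgn \<mu> (x - y)"
    by (simp add: gderiv_def soft_sgn_def soft_norm_def power2_norm_eq_inner mult_ac)
qed

end

lemma soft_norm_commute: "soft_norm \<mu> (x - y) = soft_norm \<mu> (y - x)"
  by (simp add: soft_norm_def norm_minus_commute)

lemma soft_sgn_commute: "- soft_sgn \<mu> (x - y) = soft_sgn \<mu> (y - x)"
  unfolding soft_sgn_def soft_norm_commute[of \<mu> x y] by (simp flip: scaleR_minus_right)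

definition torus_continuous :: "(real ^ 'n \<Rightarrow> real \<Rightarrow> real) \<Rightarrow> bool" where
  "torus_continuous u \<longleftrightarrow> continuous_on (UNIV \<times> {0..}) (\<lambda>(x, t). u x t) \<and>
     (\<forall>t\<ge>0. torus_periodic (\<lambda>x. u x t))"

lemma torus_continuous_bounded:
  assumes "torus_continuous u"
  obtains B where "B > 0" "\<And>x t. t \<in> {0..T} \<Longrightarrow> \<bar>u x t\<bar> \<le> B"
proof (rule periodic_bounded[of "{0..T}" u])
  show "continuous_on (UNIV \<times> {0..T}) (\<lambda>(x, t). u x t)"
    using assms unfolding torus_continuous_def
    by (auto intro: continuous_on_subset[of "UNIV \<times> {0..}"])
qed (use assms in \<open>auto simp: torus_continuous_def intro: that\<close>)

lemma torus_continuous_uniform: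
  assumes "torus_continuous u" "e > 0"
  obtains d where "d > 0" "\<And>x y t s. t \<in> {0..T} \<Longrightarrow> s \<in> {0..T} \<Longrightarrow> norm (x - y) < d \<Longrightarrow>
    \<bar>t - s\<bar> < d \<Longrightarrow> \<bar>u x t - u y s\<bar> < e"
proof (rule periodic_uniformly_continuous[of "{0..T}" u e])
  show "continuous_on (UNIV \<times> {0..T}) (\<lambda>(x, t). u x t)"
    using assms unfolding torus_continuous_def
    by (auto intro: continuous_on_subset[of "UNIV \<times> {0..}"])
qed (use assms in \<open>auto simp: torus_continuous_def dist_real_def intro: that\<close>)

text \<open>
  The functional whose maximum produces the viscosity inequalities. The penalty \<open>P\<close> is meant to
  vanish up to the time horizon and to grow afterwards, which keeps the maximum away from the end
  of the time interval; \<open>\<eta>\<close> makes the subsolution strict.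
\<close>

definition doubled :: "(real ^ 'n \<Rightarrow> real \<Rightarrow> real) \<Rightarrow> (real ^ 'n \<Rightarrow> real \<Rightarrow> real) \<Rightarrow> real \<Rightarrow> real \<Rightarrow> real \<Rightarrow> real \<Rightarrow>
    (real \<Rightarrow> real) \<Rightarrow> real ^ 'n \<Rightarrow> real \<Rightarrow> real ^ 'n \<Rightarrow> real \<Rightarrow> real" where
  "doubled u w L \<mu> \<epsilon> \<eta> P x t y s =
     u x t - w y s - L * soft_norm \<mu> (x - y) - (t - s)\<^sup>2 / (2 * \<epsilon>) - \<eta> * t - P t - P s"

text \<open>
  Translating both space variables by the same integer vector leaves the functional unchanged, so
  the first one may be taken in the unit cube. The soft norm then confines the second one.
\<close>

lemma doubled_attains_max:
  fixes u w :: "real ^ 'n \<Rightarrow> real \<Rightarrow> real"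
  assumes u: "torus_continuous u" and w: "torus_continuous w"
    and "\<mu> > 0" "L > 0" "\<epsilon> > 0" "\<eta> \<ge> 0" "T \<ge> 0" "A \<ge> 0"
    and Bu: "\<And>x t. t \<in> {0..T + 1} \<Longrightarrow> \<bar>u x t\<bar> \<le> B" and Bw: "\<And>x t. t \<in> {0..T + 1} \<Longrightarrow> \<bar>w x t\<bar> \<le> B"
    and P: "P = (\<lambda>r. A * (max 0 (r - T))\<^sup>2)"
  obtains x t y s where "t \<in> {0..T + 1}" "s \<in> {0..T + 1}"
    "\<forall>x'. \<forall>t'\<in>{0..T + 1}. \<forall>y'. \<forall>s'\<in>{0..T + 1}.
      doubled u w L \<mu> \<epsilon> \<eta> P x' t' y' s' \<le> doubled u w L \<mu> \<epsilon> \<eta> P x t y s"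
proof -
  define I where "I = {0..T + 1}"
  define \<Phi> where "\<Phi> = doubled u w L \<mu> \<epsilon> \<eta> P"
  obtain r where r: "r > 0" "\<And>x :: real ^ 'n. x \<in> cbox 0 1 \<Longrightarrow> norm x \<le> r"
    using unit_cube_norm_bound by blast
  (* Beyond this distance of the space variables the functional does not exceed its value
     at the origin, which is at least - 2 * B - L * \<mu>. *)
  define D where "D = 4 * B / L + \<mu>"
  have "B \<ge> 0"
    using Bu[of 0 0] \<open>T \<ge> 0\<close> by simp
  then have "D \<ge> 0"
    using assms by (simp add: D_def)
  define Z where "Z = (cbox (0 :: real ^ 'n) 1 \<times> I) \<times> (cball (0 :: real ^ 'n) (D + r) \<times> I)"
  have "compact Z"
    unfolding Z_def I_def by (intro compact_Times compact_cbox compact_cball compact_Icc)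
  have "(0 :: real ^ 'n) \<in> cbox 0 1"
    unfolding mem_box_cart by simp
  then have z0: "((0, 0), (0, 0)) \<in> Z"
    using \<open>T \<ge> 0\<close> \<open>D \<ge> 0\<close> r(1) by (simp add: Z_def I_def)
  have "continuous_on Z (\<lambda>z. \<Phi> (fst (fst z)) (snd (fst z)) (fst (snd z)) (snd (snd z)))"
  proof -
    have cu: "continuous_on Z (\<lambda>z. u (fst (fst z)) (snd (fst z)))"
    proof -
      have "continuous_on (UNIV \<times> {0..}) (\<lambda>z. u (fst z) (snd z))"
        using u by (simp add: torus_continuous_def case_prod_unfold)
      then show ?thesis
        by (rule continuous_on_compose2[OF _ continuous_on_fst[OF continuous_on_id]]) (auto simp: Z_def I_def)
    qed
    have cw: "continuous_on Z (\<lambda>z. w (fst (snd z)) (snd (snd z)))"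
    proof -
      have "continuous_on (UNIV \<times> {0..}) (\<lambda>z. w (fst z) (snd z))"
        using w by (simp add: torus_continuous_def case_prod_unfold)
      then show ?thesis
        by (rule continuous_on_compose2[OF _ continuous_on_snd[OF continuous_on_id]]) (auto simp: Z_def I_def)
    qed
    show ?thesis
      unfolding \<Phi>_def doubled_def P soft_norm_def using \<open>\<epsilon> > 0\<close>
      by (intro continuous_intros cu cw) auto
  qed
  then obtain z where z: "z \<in> Z" "\<And>z'. z' \<in> Z \<Longrightarrow>
      \<Phi> (fst (fst z')) (snd (fst z')) (fst (snd z')) (snd (snd z'))
      \<le> \<Phi> (fst (fst z)) (snd (fst z)) (fst (snd z)) (snd (snd z))"
    using continuous_attains_sup[OF \<open>compact Z\<close>] z0 by blast
  obtain x t y s where zeq: "z = ((x, t), (y, s))" by (metis surj_pair)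
  have max_Z: "\<Phi> x' t' y' s' \<le> \<Phi> x t y s" if "((x', t'), (y', s')) \<in> Z" for x' t' y' s'
    using z(2)[OF that] by (simp add: zeq)
  have max_all: "\<Phi> x' t' y' s' \<le> \<Phi> x t y s" if t': "t' \<in> I" and s': "s' \<in> I" for x' t' y' s'
  proof (cases "norm (x' - y') \<le> D")
    case True
    obtain k :: "real ^ 'n" where k: "\<And>i. k $ i \<in> \<int>" "x' + k \<in> cbox 0 1"
      using integer_translate_in_unit_cube[of x'] by blast
    have "u (x' + k) t' = u x' t'" "w (y' + k) s' = w y' s'"
      using u w k(1) t' s' by (auto simp: torus_continuous_def torus_periodic_def I_def)
    then have "\<Phi> (x' + k) t' (y' + k) s' = \<Phi> x' t' y' s'"
      by (simp add: \<Phi>_def doubled_def)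
    moreover have "norm (y' + k) \<le> D + r"
      using norm_triangle_ineq4[of "x' + k" "x' - y'"] r(2)[OF k(2)] True by (simp add: algebra_simps)
    then have "\<Phi> (x' + k) t' (y' + k) s' \<le> \<Phi> x t y s"
      using k(2) t' s' by (intro max_Z) (simp add: Z_def)
    ultimately show ?thesis by simp
  next
    case False
    have "L * D \<le> L * soft_norm \<mu> (x' - y')"
      using False norm_le_soft_norm[of \<mu> "x' - y'"] \<open>\<mu> > 0\<close> \<open>L > 0\<close> by (intro mult_left_mono) auto
    moreover have "L * D = 4 * B + L * \<mu>"
      using \<open>L > 0\<close> by (simp add: D_def field_simps)
    moreover have "0 \<le> (t' - s')\<^sup>2 / (2 * \<epsilon>)" "0 \<le> \<eta> * t'" "0 \<le> P t'" "0 \<le> P s'"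
      using assms t' by (auto simp: P I_def)
    ultimately have "\<Phi> x' t' y' s' \<le> 2 * B - (4 * B + L * \<mu>)"
      using Bu[of t' x'] Bw[of s' y'] t' s' unfolding \<Phi>_def doubled_def I_def by linarith
    also have "\<dots> \<le> \<Phi> 0 0 0 0"
      using Bu[of 0 0] Bw[of 0 0] \<open>T \<ge> 0\<close> \<open>\<mu> > 0\<close>
      unfolding \<Phi>_def doubled_def by (simp add: soft_norm_zero P)
    also have "\<dots> \<le> \<Phi> x t y s"
      by (rule max_Z[OF z0])
    finally show ?thesis .
  qed
  show ?thesis
    using that[of t s x y] max_all z(1) unfolding zeq Z_def I_def \<Phi>_def by auto
qed

text \<open>
  With \<open>y\<close> and \<open>s\<close> frozen at the maximum, the penalties are a test function touching \<open>u\<close> from above,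
  and symmetrically for \<open>w\<close>. Both have the same space gradient, because the penalty depends on
  \<open>x - y\<close> only; the contributions of \<open>P\<close> have the favourable sign because \<open>P\<close> is nondecreasing.
\<close>

lemma doubling_maximum:
  fixes u w :: "real ^ 'n \<Rightarrow> real \<Rightarrow> real"
  assumes sub: "space_time_sub H u" and super: "space_time_super H w"
    and u: "torus_continuous u" and w: "torus_continuous w"
    and "\<mu> > 0" "L > 0" "\<epsilon> > 0" "\<eta> \<ge> 0" "T \<ge> 0"
  obtains P x t y s where
    "mono P" "\<forall>r\<le>T. P r = 0" "t \<in> {0..T + 1}" "s \<in> {0..T + 1}"
    "\<forall>x'. \<forall>t'\<in>{0..T + 1}. \<forall>y'. \<forall>s'\<in>{0..T + 1}.
      doubled u w L \<mu> \<epsilon> \<eta> P x' t' y' s' \<le> doubled u w L \<mu> \<epsilon> \<eta> P x t y s"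
    "t > 0 \<longrightarrow> (t - s) / \<epsilon> + \<eta> + H x (L *\<^sub>R soft_sgn \<mu> (x - y)) \<le> 0"
    "s > 0 \<longrightarrow> (t - s) / \<epsilon> + H y (L *\<^sub>R soft_sgn \<mu> (x - y)) \<ge> 0"
proof -
  obtain B1 where B1: "B1 > 0" "\<And>x t. t \<in> {0..T + 1} \<Longrightarrow> \<bar>u x t\<bar> \<le> B1"
    using torus_continuous_bounded[OF u] by blast
  obtain B2 where B2: "B2 > 0" "\<And>x t. t \<in> {0..T + 1} \<Longrightarrow> \<bar>w x t\<bar> \<le> B2"
    using torus_continuous_bounded[OF w] by blast
  define B where "B = max B1 B2"
  have "B > 0" and Bu: "\<And>x t. t \<in> {0..T + 1} \<Longrightarrow> \<bar>u x t\<bar> \<le> B"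
    and Bw: "\<And>x t. t \<in> {0..T + 1} \<Longrightarrow> \<bar>w x t\<bar> \<le> B"
    using B1(1) by (auto simp: B_def intro: max.coboundedI1[OF B1(2)] max.coboundedI2[OF B2(2)])
  (* The penalty at time T + 1 outweighs the oscillation of all the other terms. *)
  define A where "A = 4 * B + L * \<mu> + 1"
  have "A > 0"
    using \<open>B > 0\<close> \<open>L > 0\<close> \<open>\<mu> > 0\<close> by (simp add: A_def add_pos_pos)
  define P where "P = (\<lambda>r. A * (max 0 (r - T))\<^sup>2)"
  define P' where "P' r = A * (2 * max 0 (r - T))" for r
  have P': "DERIV P r :> P' r" for r
  proof -
    have "DERIV (\<lambda>r. (max 0 (r - T))\<^sup>2) r :> 2 * max 0 (r - T) * 1"
      by (rule DERIV_chain2[OF DERIV_positive_part_squared]) (auto intro!: derivative_eq_intros)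
    from DERIV_cmult[OF this, of A] show ?thesis
      by (simp add: P_def P'_def)
  qed
  have P'_nonneg: "P' r \<ge> 0" for r
    using \<open>A > 0\<close> by (simp add: P'_def)
  have contP': "continuous_on UNIV P'"
    unfolding P'_def by (intro continuous_intros)
  have "mono P"
    unfolding P_def using \<open>A > 0\<close> by (intro monoI mult_left_mono power_mono) auto
  have P0: "P r = 0" if "r \<le> T" for r
    using that by (simp add: P_def)
  have P_nonneg: "P r \<ge> 0" for r
    using \<open>A > 0\<close> by (simp add: P_def)
  obtain x t y s where ts: "t \<in> {0..T + 1}" "s \<in> {0..T + 1}" and
    max_all: "\<forall>x'. \<forall>t'\<in>{0..T + 1}. \<forall>y'. \<forall>s'\<in>{0..T + 1}.
      doubled u w L \<mu> \<epsilon> \<eta> P x' t' y' s' \<le> doubled u w L \<mu> \<epsilon> \<eta> P x t y s"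
    by (rule doubled_attains_max[OF u w \<open>\<mu> > 0\<close> \<open>L > 0\<close> \<open>\<epsilon> > 0\<close> \<open>\<eta> \<ge> 0\<close> \<open>T \<ge> 0\<close> less_imp_le[OF \<open>A > 0\<close>] Bu Bw P_def]) blast
  have max: "doubled u w L \<mu> \<epsilon> \<eta> P x' t' y' s' \<le> doubled u w L \<mu> \<epsilon> \<eta> P x t y s"
    if "t' \<in> {0..T + 1}" "s' \<in> {0..T + 1}" for x' t' y' s'
    using max_all that by blast
  have "P t < A" "P s < A"
  proof -
    have "- 2 * B - L * \<mu> \<le> doubled u w L \<mu> \<epsilon> \<eta> P 0 0 0 0"
      using Bu[of 0 0] Bw[of 0 0] \<open>T \<ge> 0\<close> \<open>\<mu> > 0\<close>
      unfolding doubled_def by (simp add: soft_norm_zero P0)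
    also have "\<dots> \<le> doubled u w L \<mu> \<epsilon> \<eta> P x t y s"
      using \<open>T \<ge> 0\<close> by (intro max) auto
    also have "\<dots> \<le> 2 * B - P t - P s"
    proof -
      have "0 \<le> L * soft_norm \<mu> (x - y)" "0 \<le> (t - s)\<^sup>2 / (2 * \<epsilon>)" "0 \<le> \<eta> * t"
        using assms ts soft_norm_pos[OF \<open>\<mu> > 0\<close>, of "x - y"] by auto
      then show ?thesis
        using Bu[OF ts(1), of x] Bw[OF ts(2), of y] unfolding doubled_def by linarith
    qed
    finally show "P t < A" "P s < A"
      using P_nonneg[of t] P_nonneg[of s] unfolding A_def by linarith+
  qed
  moreover have "P (T + 1) = A"
    by (simp add: P_def)
  ultimately have "t \<noteq> T + 1" "s \<noteq> T + 1"
    by auto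
  with ts have t: "t < T + 1" "s < T + 1" by auto
  have sub': "(t - s) / \<epsilon> + \<eta> + H x (L *\<^sub>R soft_sgn \<mu> (x - y)) \<le> 0" if "t > 0"
  proof -
    have "entire_test (\<lambda>z. L * soft_norm \<mu> (fst z - y) + ((snd z - s)\<^sup>2 / (2 * \<epsilon>) + \<eta> * snd z + P (snd z)))
        (\<lambda>z. (L *\<^sub>R soft_sgn \<mu> (fst z - y), (snd z - s) / \<epsilon> + \<eta> + P' (snd z)))"
      using \<open>\<epsilon> > 0\<close> by (intro entire_test_separated soft_norm_test[OF \<open>\<mu> > 0\<close>])
        (auto intro!: derivative_eq_intros P' continuous_intros contP' simp: field_simps)
    moreover have "\<forall>\<^sub>F z in nhds (x, t). u (fst z) (snd z) - (L * soft_norm \<mu> (fst z - y) +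
          ((snd z - s)\<^sup>2 / (2 * \<epsilon>) + \<eta> * snd z + P (snd z)))
        \<le> u x t - (L * soft_norm \<mu> (fst (x, t) - y) +
          ((snd (x, t) - s)\<^sup>2 / (2 * \<epsilon>) + \<eta> * snd (x, t) + P (snd (x, t))))"
    proof -
      have "open (UNIV \<times> {0<..<T + 1})" "(x, t) \<in> UNIV \<times> {0<..<T + 1}"
        using t that by (auto intro: open_Times)
      then have "\<forall>\<^sub>F z in nhds (x, t). z \<in> UNIV \<times> {0<..<T + 1}"
        by (rule eventually_nhds_in_open)
      then show ?thesis
      proof eventually_elim
        case (elim z)
        then show ?case
          using max[of "snd z" s "fst z" y] ts(2) by (auto simp: doubled_def)
      qed
    qed
    ultimately have "(t - s) / \<epsilon> + \<eta> + P' t + H x (L *\<^sub>R soft_sgn \<mu> (x - y)) \<le> 0"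
      using sub[unfolded space_time_sub_def, rule_format, OF _ that] by fastforce
    with P'_nonneg[of t] show ?thesis by linarith
  qed
  have super': "(t - s) / \<epsilon> + H y (L *\<^sub>R soft_sgn \<mu> (x - y)) \<ge> 0" if "s > 0"
  proof -
    have "entire_test (\<lambda>z. (- L) * soft_norm \<mu> (fst z - x) + (- (snd z - t)\<^sup>2 / (2 * \<epsilon>) - P (snd z)))
        (\<lambda>z. ((- L) *\<^sub>R soft_sgn \<mu> (fst z - x), (t - snd z) / \<epsilon> - P' (snd z)))"
      using \<open>\<epsilon> > 0\<close> by (intro entire_test_separated soft_norm_test[OF \<open>\<mu> > 0\<close>])
        (auto intro!: derivative_eq_intros P' continuous_intros contP' simp: field_simps)
    moreover have "\<forall>\<^sub>F z in nhds (y, s). w (fst z) (snd z) - ((- L) * soft_norm \<mu> (fst z - x) +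
          (- (snd z - t)\<^sup>2 / (2 * \<epsilon>) - P (snd z)))
        \<ge> w y s - ((- L) * soft_norm \<mu> (fst (y, s) - x) +
          (- (snd (y, s) - t)\<^sup>2 / (2 * \<epsilon>) - P (snd (y, s))))"
    proof -
      have "open (UNIV \<times> {0<..<T + 1})" "(y, s) \<in> UNIV \<times> {0<..<T + 1}"
        using t that by (auto intro: open_Times)
      then have "\<forall>\<^sub>F z in nhds (y, s). z \<in> UNIV \<times> {0<..<T + 1}"
        by (rule eventually_nhds_in_open)
      then show ?thesis
      proof eventually_elim
        case (elim z)
        then show ?case
          using max[of t "snd z" x "fst z"] ts(1)
          by (auto simp: doubled_def soft_norm_commute[of \<mu> x] power2_commute[of t])
      qed
    qed
    ultimately have "(t - s) / \<epsilon> - P' s + H y ((- L) *\<^sub>R soft_sgn \<mu> (y - x)) \<ge> 0"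
      using super[unfolded space_time_super_def, rule_format, OF _ that] by fastforce
    moreover have "(- L) *\<^sub>R soft_sgn \<mu> (y - x) = L *\<^sub>R soft_sgn \<mu> (x - y)"
      unfolding soft_sgn_commute[of \<mu> x y, symmetric] by simp
    ultimately show ?thesis
      using P'_nonneg[of s] by simp
  qed
  show ?thesis
  proof (rule that)
    show "\<forall>r\<le>T. P r = 0" using P0 by simp
    show "t > 0 \<longrightarrow> (t - s) / \<epsilon> + \<eta> + H x (L *\<^sub>R soft_sgn \<mu> (x - y)) \<le> 0"
      using sub' by simp
    show "s > 0 \<longrightarrow> (t - s) / \<epsilon> + H y (L *\<^sub>R soft_sgn \<mu> (x - y)) \<ge> 0"
      using super' by simp
  qed (fact \<open>mono P\<close> ts max_all)+
qed

section \<open>Comparison and Lipschitz estimates\<close>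

text \<open>
  For large \<open>p\<close> the function \<open>H(\<cdot>, p)\<close> is large in absolute value and of one sign. The sign may
  depend on \<open>p\<close>, so this is weaker than coercivity.
\<close>

definition sign_coercive :: "(real ^ 'n \<Rightarrow> real ^ 'n \<Rightarrow> real) \<Rightarrow> bool" where
  "sign_coercive H \<longleftrightarrow>
     (\<forall>C. \<exists>R>0. \<forall>p. norm p \<ge> R \<longrightarrow> (\<forall>x. H x p > C) \<or> (\<forall>x. H x p < - C))"

definition torus_hamiltonian :: "(real ^ 'n \<Rightarrow> real ^ 'n \<Rightarrow> real) \<Rightarrow> bool" where
  "torus_hamiltonian H \<longleftrightarrow> continuous_on UNIV (\<lambda>(x, p). H x p) \<and> (\<forall>p. torus_periodic (\<lambda>x. H x p))"

text \<open>
  Two-sided information on \<open>H\<close> at the same momentum but at different points excludes both signs of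
  a large \<open>H(\<cdot>, p)\<close>, so the momentum is small. The soft norm has a small gradient only near the
  origin.
\<close>

lemma doubling_point_close:
  fixes H :: "real ^ 'n \<Rightarrow> real ^ 'n \<Rightarrow> real"
  assumes R: "\<forall>p. norm p \<ge> R \<longrightarrow> (\<forall>x. H x p > C) \<or> (\<forall>x. H x p < - C)"
    and "\<mu> > 0" "L \<ge> 2 * R" "R > 0"
    and "H x (L *\<^sub>R soft_sgn \<mu> (x - y)) \<le> C" "H y (L *\<^sub>R soft_sgn \<mu> (x - y)) \<ge> - C"
  shows "norm (x - y) < \<mu>"
proof (rule ccontr)
  assume "\<not> norm (x - y) < \<mu>"
  then have "1 / 2 \<le> norm (soft_sgn \<mu> (x - y))"
    using \<open>\<mu> > 0\<close> by (intro norm_soft_sgn_ge) auto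
  then have "L * (1 / 2) \<le> L * norm (soft_sgn \<mu> (x - y))"
    using assms by (intro mult_left_mono) auto
  moreover have "norm (L *\<^sub>R soft_sgn \<mu> (x - y)) = L * norm (soft_sgn \<mu> (x - y))"
    using assms by simp
  ultimately have "R \<le> norm (L *\<^sub>R soft_sgn \<mu> (x - y))"
    using \<open>L \<ge> 2 * R\<close> by linarith
  with R have "H x (L *\<^sub>R soft_sgn \<mu> (x - y)) > C \<or> H y (L *\<^sub>R soft_sgn \<mu> (x - y)) < - C"
    by blast
  with assms(5,6) show False
    by linarith
qed

text \<open>
  The difference \<open>H y p - H x p\<close> is controlled by an a priori bound on the momentum \<open>p\<close> at the doubling
  point. The parameters are chosen in the order \<open>\<epsilon>\<close>, \<open>L\<close>, \<open>\<mu>\<close>: fixing \<open>\<epsilon>\<close> bounds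
  the time derivatives of the test functions, hence the momentum by a constant depending on \<open>\<epsilon>\<close>; as
  \<open>\<mu>\<close> then tends to zero, the space variables merge while the momentum stays in a fixed ball, where
  uniform continuity of \<open>H\<close> suffices.
\<close>

lemma comparison_principle:
  fixes u w :: "real ^ 'n \<Rightarrow> real \<Rightarrow> real"
  assumes ham: "torus_hamiltonian H" and coer: "sign_coercive H"
    and sub: "space_time_sub H u" and super: "space_time_super H w"
    and u: "torus_continuous u" and w: "torus_continuous w"
    and init: "\<And>x. u x 0 \<le> w x 0" and "t1 \<ge> 0"
  shows "u x1 t1 \<le> w x1 t1"
proof (rule ccontr)
  assume "\<not> u x1 t1 \<le> w x1 t1"
  define T where "T = t1"
  define \<sigma> where "\<sigma> = (u x1 t1 - w x1 t1) / 2"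
  have "\<sigma> > 0" "T \<ge> 0"
    using \<open>\<not> u x1 t1 \<le> w x1 t1\<close> \<open>t1 \<ge> 0\<close> by (auto simp: \<sigma>_def T_def)
  obtain B1 where B1: "B1 > 0" "\<And>x t. t \<in> {0..T + 1} \<Longrightarrow> \<bar>u x t\<bar> \<le> B1"
    using torus_continuous_bounded[OF u] by blast
  obtain B2 where B2: "B2 > 0" "\<And>x t. t \<in> {0..T + 1} \<Longrightarrow> \<bar>w x t\<bar> \<le> B2"
    using torus_continuous_bounded[OF w] by blast
  define B where "B = B1 + B2"
  have "B > 0" using B1 B2 by (simp add: B_def)
  have B: "u x t - w y s \<le> B" if "t \<in> {0..T + 1}" "s \<in> {0..T + 1}" for x t y s
    using B1(2)[OF that(1), of x] B2(2)[OF that(2), of y] unfolding B_def by linarith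
  have "\<sigma> / 2 > 0" using \<open>\<sigma> > 0\<close> by simp
  obtain \<rho>1 where \<rho>1: "\<rho>1 > 0" "\<And>x y t s. t \<in> {0..T + 1} \<Longrightarrow> s \<in> {0..T + 1} \<Longrightarrow> norm (x - y) < \<rho>1 \<Longrightarrow>
      \<bar>t - s\<bar> < \<rho>1 \<Longrightarrow> \<bar>u x t - u y s\<bar> < \<sigma> / 2"
    using torus_continuous_uniform[OF u \<open>\<sigma> / 2 > 0\<close>] by metis
  obtain \<rho>2 where \<rho>2: "\<rho>2 > 0" "\<And>x y t s. t \<in> {0..T + 1} \<Longrightarrow> s \<in> {0..T + 1} \<Longrightarrow> norm (x - y) < \<rho>2 \<Longrightarrow>
      \<bar>t - s\<bar> < \<rho>2 \<Longrightarrow> \<bar>w x t - w y s\<bar> < \<sigma> / 2"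
    using torus_continuous_uniform[OF w \<open>\<sigma> / 2 > 0\<close>] by metis
  define \<rho> where "\<rho> = min \<rho>1 \<rho>2"
  have "\<rho> > 0" using \<rho>1 \<rho>2 by (simp add: \<rho>_def)
  define \<eta> where "\<eta> = \<sigma> / (2 * (T + 1))"
  have "\<eta> > 0" using \<open>\<sigma> > 0\<close> \<open>T \<ge> 0\<close> by (simp add: \<eta>_def)
  have "\<eta> * T \<le> \<sigma> / 2"
    using \<open>\<sigma> > 0\<close> \<open>T \<ge> 0\<close> by (simp add: \<eta>_def field_simps)
  (* The functional is positive at its maximum, so (t - s)^2 <= 2 * B * \<epsilon> < \<rho>^2 there. *)
  define \<epsilon> where "\<epsilon> = \<rho>\<^sup>2 / (4 * B)"
  have "\<epsilon> > 0" using \<open>\<rho> > 0\<close> \<open>B > 0\<close> by (simp add: \<epsilon>_def)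
  (* A bound on the time derivative (t - s) / \<epsilon> of the test functions. *)
  define C where "C = \<rho> / \<epsilon>"
  obtain R where R: "R > 0" "\<forall>p. norm p \<ge> R \<longrightarrow> (\<forall>x. H x p > C) \<or> (\<forall>x. H x p < - C)"
    using coer unfolding sign_coercive_def by blast
  (* The first bound keeps the momentum above R where the space variables are \<mu>-apart,
     the second one forces them to be \<rho>-close. *)
  define L where "L = max (2 * R) (2 * B / \<rho>)"
  have L: "L \<ge> 2 * R" "L > 0"
    using R(1) by (auto simp: L_def)
  have "2 * B / \<rho> \<le> L" by (simp add: L_def)
  then have "2 * B \<le> L * \<rho>"
    using \<open>\<rho> > 0\<close> by (simp add: field_simps)
  obtain d where d: "d > 0" "\<And>x y p q. p \<in> cball 0 L \<Longrightarrow> q \<in> cball 0 L \<Longrightarrow> norm (x - y) < d \<Longrightarrow>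
      dist p q < d \<Longrightarrow> \<bar>H x p - H y q\<bar> < \<eta>"
  proof (rule periodic_uniformly_continuous[of "cball 0 L" H \<eta>])
    show "continuous_on (UNIV \<times> cball 0 L) (\<lambda>(x, p). H x p)"
      using ham unfolding torus_hamiltonian_def by (auto intro: continuous_on_subset)
    show "torus_periodic (\<lambda>x. H x p)" for p
      using ham by (simp add: torus_hamiltonian_def)
  qed (use \<open>\<eta> > 0\<close> in auto)
  define \<mu> where "\<mu> = min d (\<sigma> / (2 * L))"
  have "\<mu> > 0" "\<mu> \<le> d" "\<mu> \<le> \<sigma> / (2 * L)"
    using d(1) L(2) \<open>\<sigma> > 0\<close> by (auto simp: \<mu>_def)
  then have "L * \<mu> \<le> \<sigma> / 2"
    using L(2) by (simp add: field_simps)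
  obtain P x t y s where P: "mono P" "\<forall>r\<le>T. P r = 0" and ts: "t \<in> {0..T + 1}" "s \<in> {0..T + 1}"
    and max: "\<forall>x'. \<forall>t'\<in>{0..T + 1}. \<forall>y'. \<forall>s'\<in>{0..T + 1}.
      doubled u w L \<mu> \<epsilon> \<eta> P x' t' y' s' \<le> doubled u w L \<mu> \<epsilon> \<eta> P x t y s"
    and sub': "t > 0 \<longrightarrow> (t - s) / \<epsilon> + \<eta> + H x (L *\<^sub>R soft_sgn \<mu> (x - y)) \<le> 0"
    and super': "s > 0 \<longrightarrow> (t - s) / \<epsilon> + H y (L *\<^sub>R soft_sgn \<mu> (x - y)) \<ge> 0"
    by (rule doubling_maximum[OF sub super u w \<open>\<mu> > 0\<close> L(2) \<open>\<epsilon> > 0\<close> less_imp_le[OF \<open>\<eta> > 0\<close>] \<open>T \<ge> 0\<close>])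
  have P_nonneg: "P r \<ge> 0" if "r \<ge> 0" for r
    using monoD[OF P(1) that] P(2) \<open>T \<ge> 0\<close> by simp
  have "\<sigma> \<le> doubled u w L \<mu> \<epsilon> \<eta> P x1 T x1 T"
    using \<open>L * \<mu> \<le> \<sigma> / 2\<close> \<open>\<eta> * T \<le> \<sigma> / 2\<close> P(2) \<open>\<mu> > 0\<close>
    by (simp add: doubled_def soft_norm_zero \<sigma>_def T_def)
  also have "\<dots> \<le> doubled u w L \<mu> \<epsilon> \<eta> P x t y s"
    using max \<open>T \<ge> 0\<close> by auto
  also have "\<dots> \<le> u x t - w y s - L * norm (x - y) - (t - s)\<^sup>2 / (2 * \<epsilon>)"
  proof -
    have "L * norm (x - y) \<le> L * soft_norm \<mu> (x - y)"
      using L(2) norm_le_soft_norm[OF \<open>\<mu> > 0\<close>] by (intro mult_left_mono) auto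
    moreover have "0 \<le> \<eta> * t" "0 \<le> P t" "0 \<le> P s"
      using ts \<open>\<eta> > 0\<close> P_nonneg by auto
    ultimately show ?thesis
      unfolding doubled_def by linarith
  qed
  finally have main: "\<sigma> + L * norm (x - y) + (t - s)\<^sup>2 / (2 * \<epsilon>) \<le> u x t - w y s"
    by simp
  moreover have "0 \<le> L * norm (x - y)" "0 \<le> (t - s)\<^sup>2 / (2 * \<epsilon>)"
    using L(2) \<open>\<epsilon> > 0\<close> by auto
  ultimately have big: "\<sigma> \<le> u x t - w y s" and "L * norm (x - y) \<le> B" and "(t - s)\<^sup>2 / (2 * \<epsilon>) \<le> B"
    using B[OF ts, of x y] \<open>\<sigma> > 0\<close> by linarith+
  then have "L * norm (x - y) < L * \<rho>"
    using \<open>2 * B \<le> L * \<rho>\<close> \<open>B > 0\<close> by linarith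
  then have near: "norm (x - y) < \<rho>"
    using L(2) by simp
  have "(t - s)\<^sup>2 \<le> \<rho>\<^sup>2 / 2"
    using \<open>(t - s)\<^sup>2 / (2 * \<epsilon>) \<le> B\<close> \<open>B > 0\<close> \<open>\<rho> > 0\<close> by (simp add: \<epsilon>_def field_simps)
  also have "\<dots> < \<rho>\<^sup>2"
    using \<open>\<rho> > 0\<close> by simp
  finally have near_t: "\<bar>t - s\<bar> < \<rho>"
    using \<open>\<rho> > 0\<close> by (metis abs_le_square_iff abs_of_pos not_le)
  (* Time zero is excluded: there u is below w, and (x, t) and (y, s) are \<rho>-close. *)
  have "t > 0"
  proof (rule ccontr)
    assume "\<not> t > 0"
    with ts have "t = 0" by simp
    then have "\<bar>w x 0 - w y s\<bar> < \<sigma> / 2"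
      using \<rho>2(2)[of 0 s x y] near near_t ts by (simp add: \<rho>_def)
    moreover have "\<sigma> \<le> u x 0 - w y s"
      using big \<open>t = 0\<close> by simp
    ultimately show False
      using init[of x] \<open>\<sigma> > 0\<close> by linarith
  qed
  have "s > 0"
  proof (rule ccontr)
    assume "\<not> s > 0"
    with ts have "s = 0" by simp
    then have "\<bar>u x t - u y 0\<bar> < \<sigma> / 2"
      using \<rho>1(2)[of t 0 x y] near near_t ts by (simp add: \<rho>_def)
    moreover have "\<sigma> \<le> u x t - w y 0"
      using big \<open>s = 0\<close> by simp
    ultimately show False
      using init[of y] \<open>\<sigma> > 0\<close> by linarith
  qed
  define p where "p = L *\<^sub>R soft_sgn \<mu> (x - y)"
  have ineq: "(t - s) / \<epsilon> + \<eta> + H x p \<le> 0" "(t - s) / \<epsilon> + H y p \<ge> 0"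
    using sub' super' \<open>t > 0\<close> \<open>s > 0\<close> by (auto simp: p_def)
  have "\<bar>(t - s) / \<epsilon>\<bar> \<le> C"
    using near_t \<open>\<epsilon> > 0\<close> by (simp add: C_def divide_right_mono)
  then have "H x p \<le> C" "H y p \<ge> - C"
    using ineq \<open>\<eta> > 0\<close> by linarith+
  then have "norm (x - y) < \<mu>"
    unfolding p_def by (rule doubling_point_close[OF R(2) \<open>\<mu> > 0\<close> L(1) R(1)])
  moreover have "norm p \<le> L"
    using mult_left_mono[OF norm_soft_sgn_le[OF \<open>\<mu> > 0\<close>, of "x - y"], of L] L(2) by (simp add: p_def)
  ultimately have "\<bar>H x p - H y p\<bar> < \<eta>"
    using d(2)[of p p x y] d(1) \<open>\<mu> \<le> d\<close> by simp
  with ineq show False by linarith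
qed

text \<open>
  Doubling with \<open>w = u\<close>. Lipschitz continuity in time bounds the time derivatives of the test
  functions by a multiple of \<open>C\<close>, independently of \<open>\<epsilon>\<close>, so the space variables are \<open>\<mu>\<close>-close at any
  maximum at positive times as soon as \<open>L\<close> exceeds a constant depending only on \<open>C\<close> and \<open>H\<close>. The
  maximum is therefore arbitrarily small, which is the Lipschitz estimate with constant \<open>L\<close>. For a
  maximum at time zero, \<open>L\<close> has to exceed the Lipschitz constant of the initial datum as well.
\<close>

lemma uniform_lipschitz_in_space:
  fixes u :: "real ^ 'n \<Rightarrow> real \<Rightarrow> real"
  assumes coer: "sign_coercive H"
    and sub: "space_time_sub H u" and super: "space_time_super H u" and u: "torus_continuous u"
    and time: "\<And>x t s. t \<ge> 0 \<Longrightarrow> s \<ge> 0 \<Longrightarrow> \<bar>u x t - u x s\<bar> \<le> C * \<bar>t - s\<bar>"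
    and init: "\<And>x y. \<bar>u x 0 - u y 0\<bar> \<le> L0 * norm (x - y)"
  obtains L where "L > 0" "\<And>x y t. t \<ge> 0 \<Longrightarrow> \<bar>u x t - u y t\<bar> \<le> L * norm (x - y)"
proof -
  define C' where "C' = \<bar>C\<bar> + 1"
  have "C' > 0" by (simp add: C'_def)
  have time': "\<bar>u x t - u x s\<bar> \<le> C' * \<bar>t - s\<bar>" if "t \<ge> 0" "s \<ge> 0" for x t s
  proof -
    have "C * \<bar>t - s\<bar> \<le> C' * \<bar>t - s\<bar>"
      by (intro mult_right_mono) (auto simp: C'_def)
    with time[OF that, of x] show ?thesis by linarith
  qed
  obtain R where R: "R > 0" "\<forall>p. norm p \<ge> R \<longrightarrow> (\<forall>x. H x p > 2 * C') \<or> (\<forall>x. H x p < - (2 * C'))"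
    using coer unfolding sign_coercive_def by blast
  define L where "L = max (2 * R) L0"
  have L: "L \<ge> 2 * R" "L > 0" "L \<ge> L0"
    using R(1) by (auto simp: L_def)
  have one_sided: "u x1 T - u y1 T \<le> L * norm (x1 - y1)" if "T \<ge> 0" for x1 y1 T
  proof (rule field_le_epsilon)
    fix e :: real assume "e > 0"
    then have "e / 4 > 0" by simp
    obtain \<rho> where \<rho>: "\<rho> > 0" "\<And>x y t s. t \<in> {0..T + 1} \<Longrightarrow> s \<in> {0..T + 1} \<Longrightarrow> norm (x - y) < \<rho> \<Longrightarrow>
        \<bar>t - s\<bar> < \<rho> \<Longrightarrow> \<bar>u x t - u y s\<bar> < e / 4"
      using torus_continuous_uniform[OF u \<open>e / 4 > 0\<close>] by metis
    define \<mu> where "\<mu> = min \<rho> (e / (4 * L))"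
    have "\<mu> > 0" "\<mu> \<le> \<rho>" "\<mu> \<le> e / (4 * L)"
      using \<rho>(1) L(2) \<open>e > 0\<close> by (auto simp: \<mu>_def)
    then have "L * \<mu> \<le> e / 4"
      using L(2) by (simp add: field_simps)
    (* At the maximum the times will be at distance at most 2 * C' * \<epsilon>. *)
    define \<epsilon> where "\<epsilon> = min (\<rho> / (4 * C')) (e / (4 * C'\<^sup>2))"
    have "\<epsilon> > 0" "\<epsilon> \<le> \<rho> / (4 * C')" "\<epsilon> \<le> e / (4 * C'\<^sup>2)"
      using \<rho>(1) \<open>C' > 0\<close> \<open>e > 0\<close> by (auto simp: \<epsilon>_def)
    then have \<epsilon>: "2 * C' * \<epsilon> < \<rho>" "C' * (2 * C' * \<epsilon>) \<le> e / 2"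
      using \<rho>(1) \<open>C' > 0\<close> by (auto simp: field_simps power2_eq_square)
    obtain P x t y s where P: "mono P" "\<forall>r\<le>T. P r = 0" and ts: "t \<in> {0..T + 1}" "s \<in> {0..T + 1}"
      and max: "\<forall>x'. \<forall>t'\<in>{0..T + 1}. \<forall>y'. \<forall>s'\<in>{0..T + 1}.
        doubled u u L \<mu> \<epsilon> 0 P x' t' y' s' \<le> doubled u u L \<mu> \<epsilon> 0 P x t y s"
      and sub': "t > 0 \<longrightarrow> (t - s) / \<epsilon> + 0 + H x (L *\<^sub>R soft_sgn \<mu> (x - y)) \<le> 0"
      and super': "s > 0 \<longrightarrow> (t - s) / \<epsilon> + H y (L *\<^sub>R soft_sgn \<mu> (x - y)) \<ge> 0"
      by (rule doubling_maximum[OF sub super u u \<open>\<mu> > 0\<close> L(2) \<open>\<epsilon> > 0\<close> order_refl \<open>T \<ge> 0\<close>])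
    have P_nonneg: "P r \<ge> 0" if "r \<ge> 0" for r
      using monoD[OF P(1) that] P(2) \<open>T \<ge> 0\<close> by simp
    have "(t - s)\<^sup>2 / (2 * \<epsilon>) \<le> C' * \<bar>t - s\<bar>"
    (* Moving the later time back to the earlier one must not increase the functional, and it
       does not increase P. *)
    proof (cases "t \<le> s")
      case True
      have "doubled u u L \<mu> \<epsilon> 0 P x t y t \<le> doubled u u L \<mu> \<epsilon> 0 P x t y s"
        using max ts by blast
      then show ?thesis
        using monoD[OF P(1) True] time'[of t s y] ts by (simp add: doubled_def)
    next
      case False
      have "doubled u u L \<mu> \<epsilon> 0 P x s y s \<le> doubled u u L \<mu> \<epsilon> 0 P x t y s"
        using max ts by blast
      then show ?thesis
        using monoD[OF P(1), of s t] False time'[of t s x] ts by (simp add: doubled_def)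
    qed
    then have "\<bar>t - s\<bar> * \<bar>t - s\<bar> \<le> (2 * C' * \<epsilon>) * \<bar>t - s\<bar>"
      using \<open>\<epsilon> > 0\<close> by (simp add: power2_eq_square field_simps)
    then have dt: "\<bar>t - s\<bar> \<le> 2 * C' * \<epsilon>"
    proof (cases "t = s")
      case True
      then show ?thesis using \<open>C' > 0\<close> \<open>\<epsilon> > 0\<close> by simp
    next
      case False
      then have "\<bar>t - s\<bar> > 0" by simp
      from mult_right_le_imp_le[OF \<open>\<bar>t - s\<bar> * \<bar>t - s\<bar> \<le> (2 * C' * \<epsilon>) * \<bar>t - s\<bar>\<close> this]
      show ?thesis .
    qed
    have Lnorm: "L * norm (x - y) \<le> L * soft_norm \<mu> (x - y)"
      using L(2) norm_le_soft_norm[OF \<open>\<mu> > 0\<close>] by (intro mult_left_mono) auto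
    have "doubled u u L \<mu> \<epsilon> 0 P x t y s \<le> u x t - u y s - L * norm (x - y)"
    proof -
      have "0 \<le> (t - s)\<^sup>2 / (2 * \<epsilon>)" "0 \<le> P t" "0 \<le> P s"
        using ts \<open>\<epsilon> > 0\<close> P_nonneg by auto
      with Lnorm show ?thesis
        unfolding doubled_def by linarith
    qed
    also have "\<dots> \<le> e / 2"
    proof (cases "t > 0 \<and> s > 0")
      case True
      have "\<bar>(t - s) / \<epsilon>\<bar> \<le> 2 * C'"
        using dt \<open>\<epsilon> > 0\<close> by (simp add: field_simps)
      then have "H x (L *\<^sub>R soft_sgn \<mu> (x - y)) \<le> 2 * C'" "H y (L *\<^sub>R soft_sgn \<mu> (x - y)) \<ge> - (2 * C')"
        using sub' super' True by linarith+
      then have "norm (x - y) < \<mu>"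
        by (rule doubling_point_close[OF R(2) \<open>\<mu> > 0\<close> L(1) R(1)])
      then have "\<bar>u x t - u y s\<bar> < e / 4"
        using ts dt \<epsilon>(1) \<open>\<mu> \<le> \<rho>\<close> by (intro \<rho>(2)) auto
      moreover have "0 \<le> L * norm (x - y)"
        using L(2) by simp
      ultimately show ?thesis
        using \<open>e > 0\<close> by linarith
    next
      case False
      then have "t + s = \<bar>t - s\<bar>"
        using ts by auto
      (* One of the times vanishes: the Lipschitz bound of the initial datum decides. *)
      have "u x t - u y s \<le> \<bar>u x t - u x 0\<bar> + \<bar>u x 0 - u y 0\<bar> + \<bar>u y 0 - u y s\<bar>"
        by linarith
      also have "\<dots> \<le> C' * t + L0 * norm (x - y) + C' * s"
        using time'[of t 0 x] time'[of 0 s y] init[of x y] ts by simp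
      also have "\<dots> = C' * \<bar>t - s\<bar> + L0 * norm (x - y)"
        by (simp flip: \<open>t + s = \<bar>t - s\<bar>\<close> add: algebra_simps)
      also have "\<dots> \<le> e / 2 + L * norm (x - y)"
        using mult_left_mono[OF dt less_imp_le[OF \<open>C' > 0\<close>]] \<epsilon>(2) mult_right_mono[OF L(3) norm_ge_zero[of "x - y"]]
        by linarith
      finally show ?thesis by simp
    qed
    finally have max_le: "doubled u u L \<mu> \<epsilon> 0 P x t y s \<le> e / 2" .
    have "u x1 T - u y1 T = doubled u u L \<mu> \<epsilon> 0 P x1 T y1 T + L * soft_norm \<mu> (x1 - y1)"
      using P(2) by (simp add: doubled_def)
    also have "\<dots> \<le> e / 2 + L * (norm (x1 - y1) + \<mu>)"
    proof (intro add_mono mult_left_mono)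
      have "doubled u u L \<mu> \<epsilon> 0 P x1 T y1 T \<le> doubled u u L \<mu> \<epsilon> 0 P x t y s"
        using max \<open>T \<ge> 0\<close> by auto
      with max_le show "doubled u u L \<mu> \<epsilon> 0 P x1 T y1 T \<le> e / 2" by simp
    qed (use soft_norm_le[OF \<open>\<mu> > 0\<close>] L(2) in auto)
    also have "\<dots> \<le> L * norm (x1 - y1) + e"
      using \<open>L * \<mu> \<le> e / 4\<close> \<open>e > 0\<close> by (simp add: algebra_simps)
    finally show "u x1 T - u y1 T \<le> L * norm (x1 - y1) + e" .
  qed
  show ?thesis
  proof (rule that[OF L(2)])
    fix x y and t :: real assume "t \<ge> 0"
    show "\<bar>u x t - u y t\<bar> \<le> L * norm (x - y)"
      using one_sided[OF \<open>t \<ge> 0\<close>, of x y] one_sided[OF \<open>t \<ge> 0\<close>, of y x]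
      by (simp add: abs_le_iff norm_minus_commute)
  qed
qed

section \<open>Stability and invariance\<close>

text \<open>
  Adding the squared distance to the contact point makes the contact strict, so it survives
  approximation: the approximating subsolutions are touched at points converging to it. As the
  perturbation has zero gradient at the contact point, the inequality passes to the limit by
  continuity.
\<close>

lemma space_time_sub_limit:
  fixes u :: "real ^ 'n \<Rightarrow> real \<Rightarrow> real"
  assumes contH: "continuous_on UNIV (\<lambda>(x, p). H x p)"
    and sub: "\<And>n::nat. space_time_sub H (U n)" and cont: "\<And>n. torus_continuous (U n)"
    and lim: "\<And>e. e > 0 \<Longrightarrow> \<exists>n. \<forall>x. \<forall>t\<ge>0. \<bar>U n x t - u x t\<bar> < e"
  shows "space_time_sub H u"
  unfolding space_time_sub_def
proof (intro allI impI)
  fix \<phi> G and x0 :: "real ^ 'n" and t0 :: real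
  assume test: "entire_test \<phi> G" and "t0 > 0"
    and touch: "\<forall>\<^sub>F z in nhds (x0, t0). u (fst z) (snd z) - \<phi> z \<le> u x0 t0 - \<phi> (x0, t0)"
  define z0 where "z0 = (x0, t0)"
  define \<phi>' where "\<phi>' z = \<phi> z + (z - z0) \<bullet> (z - z0)" for z
  define G' where "G' z = G z + 2 *\<^sub>R (z - z0)" for z
  have G: "continuous_on UNIV G" "\<And>z. GDERIV \<phi> z :> G z"
    using test by (auto simp: entire_test_def)
  have contG': "continuous_on UNIV G'"
    unfolding G'_def by (intro continuous_intros G(1))
  have G': "GDERIV \<phi>' z :> G' z" for z
  proof -
    have "((\<lambda>z. \<phi> z + (z - z0) \<bullet> (z - z0)) has_derivative
        (\<lambda>h. h \<bullet> G z + ((z - z0) \<bullet> h + h \<bullet> (z - z0)))) (at z)"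
      by (intro has_derivative_add G(2)[unfolded gderiv_def])
        (auto intro!: derivative_eq_intros)
    then show ?thesis
      by (simp add: gderiv_def \<phi>'_def[abs_def] G'_def inner_add_right inner_commute)
  qed
  have test': "entire_test \<phi>' G'"
    using contG' G' by (simp add: entire_test_def)
  have cont\<phi>': "continuous_on UNIV \<phi>'"
    using G' unfolding gderiv_def
    by (blast intro: continuous_at_imp_continuous_on has_derivative_continuous)
  (* The equation evaluated on the perturbed test function, as a continuous function of the
     point. *)
  define \<Psi> where "\<Psi> z = snd (G' z) + H (fst z) (fst (G' z))" for z
  have "continuous_on UNIV \<Psi>"
  proof -
    have "continuous_on UNIV (\<lambda>z. (fst z, fst (G' z)))"
      by (intro continuous_intros contG')
    from continuous_on_compose2[OF contH this]
    have "continuous_on UNIV (\<lambda>z. H (fst z) (fst (G' z)))"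
      by simp
    then show ?thesis
      unfolding \<Psi>_def by (intro continuous_intros contG')
  qed
  obtain r where "r > 0" and r: "\<And>z. dist z z0 < r \<Longrightarrow> u (fst z) (snd z) - \<phi> z \<le> u x0 t0 - \<phi> z0"
    using touch unfolding eventually_nhds_metric z0_def by auto
  have near: "\<exists>z. dist z z0 < \<delta> \<and> \<Psi> z \<le> 0" if "\<delta> > 0" for \<delta>
  proof -
    define \<delta>' where "\<delta>' = min (\<delta> / 2) (min (r / 2) (t0 / 2))"
    have \<delta>': "\<delta>' > 0" "\<delta>' < \<delta>" "\<delta>' < r" "\<delta>' < t0"
      using that \<open>r > 0\<close> \<open>t0 > 0\<close> by (auto simp: \<delta>'_def)
    have time_pos: "snd z > 0" if "dist z z0 \<le> \<delta>'" for z
      using dist_snd_le[of z z0] that \<delta>'(4) by (simp add: z0_def dist_real_def)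
    have "\<delta>'\<^sup>2 / 2 > 0" using \<delta>'(1) by simp
    from lim[OF this] obtain n where n: "\<And>x t. t \<ge> 0 \<Longrightarrow> \<bar>U n x t - u x t\<bar> < \<delta>'\<^sup>2 / 2"
      by blast
    have "continuous_on (cball z0 \<delta>') (\<lambda>z. U n (fst z) (snd z) - \<phi>' z)"
    proof (intro continuous_on_diff)
      have "continuous_on (UNIV \<times> {0..}) (\<lambda>z. U n (fst z) (snd z))"
        using cont[of n] by (simp add: torus_continuous_def case_prod_unfold)
      then show "continuous_on (cball z0 \<delta>') (\<lambda>z. U n (fst z) (snd z))"
        by (rule continuous_on_subset) (use time_pos in \<open>force simp: dist_commute\<close>)
      show "continuous_on (cball z0 \<delta>') \<phi>'"
        using cont\<phi>' by (rule continuous_on_subset) simp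
    qed
    moreover have "cball z0 \<delta>' \<noteq> {}"
      using \<delta>'(1) by simp
    ultimately obtain z where z: "z \<in> cball z0 \<delta>'"
      and zmax: "\<And>z'. z' \<in> cball z0 \<delta>' \<Longrightarrow> U n (fst z') (snd z') - \<phi>' z' \<le> U n (fst z) (snd z) - \<phi>' z"
      using continuous_attains_sup[of "cball z0 \<delta>'" "\<lambda>z. U n (fst z) (snd z) - \<phi>' z"] compact_cball
      by blast
    have zd: "dist z z0 \<le> \<delta>'" using z by (simp add: dist_commute)
    have "(norm (z - z0))\<^sup>2 < \<delta>'\<^sup>2"
    proof -
      have "U n x0 t0 - \<phi> z0 \<le> U n (fst z) (snd z) - \<phi> z - (norm (z - z0))\<^sup>2"
        using zmax[of z0] \<delta>'(1) by (simp add: \<phi>'_def z0_def power2_norm_eq_inner)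
      moreover have "u (fst z) (snd z) - \<phi> z \<le> u x0 t0 - \<phi> z0"
        using zd \<delta>'(3) by (intro r) simp
      moreover have "\<bar>U n x0 t0 - u x0 t0\<bar> < \<delta>'\<^sup>2 / 2" "\<bar>U n (fst z) (snd z) - u (fst z) (snd z)\<bar> < \<delta>'\<^sup>2 / 2"
        using n \<open>t0 > 0\<close> time_pos[OF zd] by auto
      ultimately show ?thesis by linarith
    qed
    then have zin: "dist z z0 < \<delta>'"
      using \<delta>'(1) by (simp add: dist_norm power2_less_imp_less)
    have "\<forall>\<^sub>F z' in nhds z. dist z' z0 < \<delta>'"
      by (rule eventually_nhds_in_open[of "{z'. dist z' z0 < \<delta>'}", simplified])
        (use zin in \<open>auto intro!: open_Collect_less continuous_intros\<close>)
    then have "\<forall>\<^sub>F z' in nhds (fst z, snd z). U n (fst z') (snd z') - \<phi>' z'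
        \<le> U n (fst z) (snd z) - \<phi>' (fst z, snd z)"
      unfolding prod.collapse by eventually_elim (use zmax in \<open>auto simp: dist_commute\<close>)
    then have "\<Psi> z \<le> 0"
      using sub[of n, unfolded space_time_sub_def, rule_format, OF test' time_pos[OF zd], of "fst z"]
      by (simp add: \<Psi>_def)
    moreover have "dist z z0 < \<delta>" using zin \<delta>'(2) by simp
    ultimately show ?thesis by blast
  qed
  have "\<Psi> z0 \<le> 0"
  proof (rule ccontr)
    assume "\<not> \<Psi> z0 \<le> 0"
    then have "\<Psi> z0 > 0" by simp
    moreover have "isCont \<Psi> z0"
      using \<open>continuous_on UNIV \<Psi>\<close> continuous_on_eq_continuous_at[OF open_UNIV, of \<Psi>] by blast
    then have "(\<Psi> \<longlongrightarrow> \<Psi> z0) (nhds z0)"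
      by (simp add: isCont_def tendsto_at_iff_tendsto_nhds)
    ultimately have "\<forall>\<^sub>F z in nhds z0. \<Psi> z > 0"
      by (rule order_tendstoD(1)[rotated])
    then obtain \<delta> where "\<delta> > 0" "\<And>z. dist z z0 < \<delta> \<Longrightarrow> \<Psi> z > 0"
      unfolding eventually_nhds_metric by blast
    with near[of \<delta>] show False by force
  qed
  then show "snd (G (x0, t0)) + H x0 (fst (G (x0, t0))) \<le> 0"
    by (simp add: \<Psi>_def G'_def z0_def)
qed

lemma space_time_super_limit:
  fixes u :: "real ^ 'n \<Rightarrow> real \<Rightarrow> real"
  assumes contH: "continuous_on UNIV (\<lambda>(x, p). H x p)"
    and super: "\<And>n::nat. space_time_super H (U n)" and cont: "\<And>n. torus_continuous (U n)"
    and lim: "\<And>e. e > 0 \<Longrightarrow> \<exists>n. \<forall>x. \<forall>t\<ge>0. \<bar>U n x t - u x t\<bar> < e"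
  shows "space_time_super H u"
  unfolding space_time_super_iff_sub
proof (rule space_time_sub_limit[of _ "\<lambda>n x t. - U n x t"])
  have "continuous_on UNIV (\<lambda>z :: (real ^ 'n) \<times> (real ^ 'n). (fst z, - snd z))"
    by (intro continuous_intros)
  from continuous_on_compose2[OF contH this]
  show "continuous_on UNIV (\<lambda>(x, p). - H x (- p))"
    unfolding case_prod_unfold by (intro continuous_on_minus) simp
  show "space_time_sub (\<lambda>x p. - H x (- p)) (\<lambda>x t. - U n x t)" for n
    using super[of n] by (simp add: space_time_super_iff_sub)
  show "torus_continuous (\<lambda>x t. - U n x t)" for n
    using cont[of n] unfolding torus_continuous_def torus_periodic_def case_prod_unfold
    by (auto intro: continuous_on_minus)
  show "\<exists>n. \<forall>x. \<forall>t\<ge>0. \<bar>- U n x t - - u x t\<bar> < e" if "e > 0" for e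
    using lim[OF that] by (simp add: abs_minus_commute)
qed

lemma entire_test_rescale:
  fixes \<phi> :: "'a::euclidean_space \<times> real \<Rightarrow> real"
  assumes "entire_test \<phi> G"
  shows "entire_test (\<lambda>z. c * \<phi> (fst z, a * snd z + b))
    (\<lambda>z. (c *\<^sub>R fst (G (fst z, a * snd z + b)), c * a * snd (G (fst z, a * snd z + b))))"
  unfolding entire_test_def
proof (intro conjI allI)
  have G: "continuous_on UNIV G" "\<And>z. GDERIV \<phi> z :> G z"
    using assms by (auto simp: entire_test_def)
  have "continuous_on UNIV (\<lambda>z. G (fst z, a * snd z + b))"
    by (intro continuous_on_compose2[OF G(1)] continuous_intros) auto
  then show "continuous_on UNIV (\<lambda>z. (c *\<^sub>R fst (G (fst z, a * snd z + b)), c * a * snd (G (fst z, a * snd z + b))))"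
    by (intro continuous_intros)
  fix z :: "'a \<times> real"
  have "((\<lambda>z. (fst z, a * snd z + b)) has_derivative (\<lambda>h. (fst h, a * snd h))) (at z)"
    by (auto intro!: derivative_eq_intros)
  from has_derivative_mult_right[OF has_derivative_compose[OF this G(2)[unfolded gderiv_def]], of c]
  show "GDERIV (\<lambda>z. c * \<phi> (fst z, a * snd z + b)) z
      :> (c *\<^sub>R fst (G (fst z, a * snd z + b)), c * a * snd (G (fst z, a * snd z + b)))"
    by (simp add: gderiv_def inner_prod_def algebra_simps)
qed

lemma space_time_sub_shift:
  assumes "space_time_sub H u" "h \<ge> 0"
  shows "space_time_sub H (\<lambda>x t. u x (t + h) + c)"
  unfolding space_time_sub_def
proof (intro allI impI)
  fix \<phi> G x0 and t0 :: real
  assume test: "entire_test \<phi> G" and "t0 > 0"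
    and touch: "\<forall>\<^sub>F z in nhds (x0, t0). u (fst z) (snd z + h) + c - \<phi> z \<le> u x0 (t0 + h) + c - \<phi> (x0, t0)"
  have "filterlim (\<lambda>z. (fst z, snd z - h)) (nhds (x0, t0)) (nhds (x0, t0 + h))"
    by (auto intro!: tendsto_eq_intros filterlim_ident)
  from eventually_compose_filterlim[OF touch this]
  have "\<forall>\<^sub>F z in nhds (x0, t0 + h). u (fst z) (snd z) - \<phi> (fst z, snd z - h) \<le> u x0 (t0 + h) - \<phi> (x0, t0)"
    by simp
  then show "snd (G (x0, t0)) + H x0 (fst (G (x0, t0))) \<le> 0"
    using assms(1)[unfolded space_time_sub_def, rule_format,
        OF entire_test_rescale[OF test, of 1 1 "- h"], of "t0 + h" x0] \<open>t0 > 0\<close> \<open>h \<ge> 0\<close>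
    by simp
qed

lemma space_time_super_shift:
  assumes "space_time_super H u" "h \<ge> 0"
  shows "space_time_super H (\<lambda>x t. u x (t + h) + c)"
  using space_time_sub_shift[OF assms(1)[unfolded space_time_super_iff_sub] assms(2), of "- c"]
  by (simp add: space_time_super_iff_sub)

text \<open>
  The time scaling is chosen so that the time derivative is multiplied by the factor
  \<open>l powr (\<theta> + 1)\<close> of the superhomogeneity of \<open>H\<close>.
\<close>

lemma space_time_super_dilate:
  assumes super: "space_time_super H u" and "l \<ge> 1"
    and hom: "\<And>x p. H x (l *\<^sub>R p) \<ge> l powr (\<theta> + 1) * H x p"
  shows "space_time_super H (\<lambda>x t. l * u x (l powr \<theta> * t))"
  unfolding space_time_super_def
proof (intro allI impI)
  fix \<phi> G x0 and t0 :: real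
  assume test: "entire_test \<phi> G" and "t0 > 0"
    and touch: "\<forall>\<^sub>F z in nhds (x0, t0). l * u (fst z) (l powr \<theta> * snd z) - \<phi> z
      \<ge> l * u x0 (l powr \<theta> * t0) - \<phi> (x0, t0)"
  define m where "m = l powr \<theta>"
  have "l > 0" "m > 0" using \<open>l \<ge> 1\<close> by (auto simp: m_def)
  have cancel: "inverse m * (m * t0) = t0"
    using \<open>m > 0\<close> by simp
  have "filterlim (\<lambda>z. (fst z, inverse m * snd z)) (nhds (x0, t0)) (nhds (x0, m * t0))"
    using \<open>m > 0\<close> by (auto intro!: tendsto_eq_intros filterlim_ident)
  from eventually_compose_filterlim[OF touch this]
  have "\<forall>\<^sub>F z in nhds (x0, m * t0). u (fst z) (snd z) - (1 / l) * \<phi> (fst z, inverse m * snd z + 0)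
      \<ge> u x0 (m * t0) - (1 / l) * \<phi> (fst (x0, m * t0), inverse m * snd (x0, m * t0) + 0)"
  proof eventually_elim
    case (elim z)
    have "l * u x0 (m * t0) - \<phi> (x0, t0) \<le> l * u (fst z) (snd z) - \<phi> (fst z, inverse m * snd z)"
      using elim \<open>m > 0\<close> by (simp add: m_def[symmetric] field_simps)
    then have "(1 / l) * (l * u x0 (m * t0) - \<phi> (x0, t0))
        \<le> (1 / l) * (l * u (fst z) (snd z) - \<phi> (fst z, inverse m * snd z))"
      using \<open>l > 0\<close> by (intro mult_left_mono) auto
    then show ?case
      using \<open>l > 0\<close> unfolding fst_conv snd_conv add_0_right cancel by (simp add: algebra_simps)
  qed
  moreover have "m * t0 > 0" using \<open>m > 0\<close> \<open>t0 > 0\<close> by simp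
  ultimately have "0 \<le> (1 / l) * inverse m * snd (G (x0, t0)) + H x0 ((1 / l) *\<^sub>R fst (G (x0, t0)))"
    using super[unfolded space_time_super_def, rule_format,
        OF entire_test_rescale[OF test, of "1 / l" "inverse m" 0], of "m * t0" x0]
    by (simp add: cancel)
  then have "0 \<le> (l * m) * ((1 / l) * inverse m * snd (G (x0, t0)) + H x0 ((1 / l) *\<^sub>R fst (G (x0, t0))))"
    using \<open>l > 0\<close> \<open>m > 0\<close> by simp
  also have "\<dots> = snd (G (x0, t0)) + l powr (\<theta> + 1) * H x0 ((1 / l) *\<^sub>R fst (G (x0, t0)))"
    using \<open>l > 0\<close> \<open>m > 0\<close> by (simp add: m_def powr_add field_simps)
  also have "\<dots> \<le> snd (G (x0, t0)) + H x0 (l *\<^sub>R ((1 / l) *\<^sub>R fst (G (x0, t0))))"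
    by (intro add_left_mono hom)
  finally show "snd (G (x0, t0)) + H x0 (fst (G (x0, t0))) \<ge> 0"
    using \<open>l > 0\<close> by simp
qed

text \<open>
  Linear growth in time turns a \<open>C\<^sup>1\<close> initial datum into a barrier.
\<close>

lemma classical_super:
  fixes g :: "real ^ 'n \<Rightarrow> real"
  assumes g: "\<And>x. GDERIV g x :> Dg x" and "\<And>x. H x (Dg x) \<ge> - K"
  shows "space_time_super H (\<lambda>x t. g x + K * t)"
  unfolding space_time_super_def
proof (intro allI impI)
  fix \<phi> G and x0 :: "real ^ 'n" and t0 :: real
  assume test: "entire_test \<phi> G" and "t0 > 0"
    and touch: "\<forall>\<^sub>F z in nhds (x0, t0). g (fst z) + K * snd z - \<phi> z \<ge> g x0 + K * t0 - \<phi> (x0, t0)"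
  have "((\<lambda>z. g (fst z) + K * snd z - \<phi> z) has_derivative
      (\<lambda>h. fst h \<bullet> Dg x0 + K * snd h - h \<bullet> G (x0, t0))) (at (x0, t0))"
  proof (intro has_derivative_diff has_derivative_add has_derivative_mult_right has_derivative_snd has_derivative_ident)
    show "((\<lambda>z. g (fst z)) has_derivative (\<lambda>h. fst h \<bullet> Dg x0)) (at (x0, t0))"
      by (rule has_derivative_compose[OF has_derivative_fst[OF has_derivative_ident]])
        (use g[of x0] in \<open>simp add: gderiv_def\<close>)
    show "(\<phi> has_derivative (\<lambda>h. h \<bullet> G (x0, t0))) (at (x0, t0))"
      using test by (simp add: entire_test_def gderiv_def)
  qed
  moreover have "\<forall>\<^sub>F z in at (x0, t0). g (fst (x0, t0)) + K * snd (x0, t0) - \<phi> (x0, t0) \<le> g (fst z) + K * snd z - \<phi> z"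
    using touch by (simp add: eventually_at_filter eventually_mono)
  ultimately have "(\<lambda>h. fst h \<bullet> Dg x0 + K * snd h - h \<bullet> G (x0, t0)) = (\<lambda>h. 0)"
    by (rule has_derivative_local_min)
  then have zero: "h \<bullet> Dg x0 + K * k - (h, k) \<bullet> G (x0, t0) = 0" for h k
    by (metis fst_conv snd_conv)
  have "Dg x0 = fst (G (x0, t0))"
    using zero[of _ 0] by (intro vector_eq_ldot[THEN iffD1]) (simp add: inner_prod_def)
  moreover have "K = snd (G (x0, t0))"
    using zero[of 0 1] by (simp add: inner_prod_def)
  ultimately show "snd (G (x0, t0)) + H x0 (fst (G (x0, t0))) \<ge> 0"
    using assms(2)[of x0] by simp
qed

lemma classical_sub:
  fixes g :: "real ^ 'n \<Rightarrow> real"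
  assumes g: "\<And>x. GDERIV g x :> Dg x" and "\<And>x. H x (Dg x) \<le> K"
  shows "space_time_sub H (\<lambda>x t. g x - K * t)"
proof -
  have "space_time_super (\<lambda>x p. - H x (- p)) (\<lambda>x t. - g x + K * t)"
    by (rule classical_super[OF GDERIV_minus[OF g]]) (use assms(2) in simp)
  then show ?thesis
    by (simp add: space_time_super_iff_sub)
qed

lemma torus_continuous_combine:
  fixes u :: "real ^ 'n \<Rightarrow> real \<Rightarrow> real"
  assumes u: "torus_continuous u" and "a \<ge> 0" "b \<ge> 0"
  shows "torus_continuous (\<lambda>x t. l * u x (a * t + b) + k * t + c)"
proof -
  have "continuous_on (UNIV \<times> {0..}) (\<lambda>z. u (fst z) (a * snd z + b))"
  proof -
    have 1: "continuous_on (UNIV \<times> {0..}) (\<lambda>z. u (fst z) (snd z))"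
      using u by (simp add: torus_continuous_def case_prod_unfold)
    have 2: "continuous_on (UNIV \<times> {0..}) (\<lambda>z :: (real ^ 'n) \<times> real. (fst z, a * snd z + b))"
      by (intro continuous_intros)
    have "(\<lambda>z :: (real ^ 'n) \<times> real. (fst z, a * snd z + b)) ` (UNIV \<times> {0..}) \<subseteq> UNIV \<times> {0..}"
      using assms by auto
    from continuous_on_compose2[OF 1 2 this] show ?thesis
      by simp
  qed
  then have "continuous_on (UNIV \<times> {0..}) (\<lambda>(x, t). l * u x (a * t + b) + k * t + c)"
    unfolding case_prod_unfold by (intro continuous_intros)
  moreover have "torus_periodic (\<lambda>x. l * u x (a * t + b) + k * t + c)" if "t \<ge> 0" for t
  proof -
    have "a * t + b \<ge> 0" using assms that by simp
    then show ?thesis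
      using u by (simp add: torus_continuous_def torus_periodic_def)
  qed
  ultimately show ?thesis
    by (simp add: torus_continuous_def)
qed

lemma torus_continuous_shift:
  assumes "torus_continuous u" "h \<ge> 0"
  shows "torus_continuous (\<lambda>x t. u x (t + h) + c)"
  using torus_continuous_combine[OF assms(1), of 1 h 1 0 c] assms(2) by simp

lemma torus_continuous_stationary:
  fixes v :: "real ^ 'n \<Rightarrow> real"
  assumes "continuous_on UNIV v" "torus_periodic v"
  shows "torus_continuous (\<lambda>x t. v x)"
  using assms unfolding torus_continuous_def case_prod_unfold
  by (auto intro!: continuous_on_compose2[OF assms(1)] continuous_intros)

section \<open>Large-time behaviour\<close>

text \<open>
  The equation does not involve the values of the solution, so adding a constant to a
  supersolution gives a supersolution.
\<close>

lemma solutions_contract: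
  fixes u w :: "real ^ 'n \<Rightarrow> real \<Rightarrow> real"
  assumes ham: "torus_hamiltonian H" "sign_coercive H"
    and "space_time_sub H u" "space_time_super H u" "torus_continuous u"
    and "space_time_sub H w" "space_time_super H w" "torus_continuous w"
    and init: "\<And>x. \<bar>u x 0 - w x 0\<bar> \<le> c" and "t \<ge> 0"
  shows "\<bar>u x t - w x t\<bar> \<le> c"
proof -
  have *: "f x t \<le> h x t + c"
    if "space_time_sub H f" "torus_continuous f" "space_time_super H h" "torus_continuous h"
      and "\<And>x. f x 0 \<le> h x 0 + c" for f h :: "real ^ 'n \<Rightarrow> real \<Rightarrow> real"
    using space_time_super_shift[OF that(3), of 0 c] torus_continuous_shift[OF that(4), of 0 c] that(5)
    by (intro comparison_principle[OF ham that(1) _ that(2) _ _ \<open>t \<ge> 0\<close>]) auto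
  have "u x t \<le> w x t + c"
    by (rule *) (use assms init in \<open>auto simp: abs_le_iff algebra_simps\<close>)
  moreover have "w x t \<le> u x t + c"
    by (rule *) (use assms init in \<open>auto simp: abs_le_iff algebra_simps\<close>)
  ultimately show ?thesis by (simp add: abs_le_iff)
qed

text \<open>
  Arzela-Ascoli on the unit cube; periodicity carries the uniform convergence over to the whole
  space.
\<close>

lemma periodic_lipschitz_uniform_subsequence:
  fixes f :: "nat \<Rightarrow> real ^ 'n \<Rightarrow> real"
  assumes per: "\<And>n. torus_periodic (f n)" and bound: "\<And>n x. \<bar>f n x\<bar> \<le> M"
    and lip: "\<And>n x y. \<bar>f n x - f n y\<bar> \<le> L * norm (x - y)" and "L > 0"
  obtains k :: "nat \<Rightarrow> nat" and g where "strict_mono k"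
    "\<And>e. e > 0 \<Longrightarrow> \<exists>N. \<forall>n\<ge>N. \<forall>x. \<bar>f (k n) x - g x\<bar> < e"
proof -
  obtain g and k :: "nat \<Rightarrow> nat" where k: "strict_mono k"
    and conv: "\<And>e. 0 < e \<Longrightarrow> \<exists>N. \<forall>n x. n \<ge> N \<and> x \<in> cbox 0 1 \<longrightarrow> norm (f (k n) x - g x) < e"
  proof (rule Arzela_Ascoli[of "cbox 0 1" f M])
    fix x :: "real ^ 'n" and e :: real assume "0 < e"
    have "norm (f n x - f n y) < e" if "norm (x - y) < e / L" for n y
      using lip[of n x y] that \<open>L > 0\<close> by (simp add: field_simps)
    then show "\<exists>d>0. \<forall>n y. y \<in> cbox 0 1 \<and> norm (x - y) < d \<longrightarrow> norm (f n x - f n y) < e"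
      using \<open>0 < e\<close> \<open>L > 0\<close> by (intro exI[of _ "e / L"]) auto
  qed (use bound in auto)
  (* The limit on the cube extends by choosing for each point a translate in the cube. *)
  define \<tau> :: "real ^ 'n \<Rightarrow> real ^ 'n" where "\<tau> x = (SOME k. (\<forall>i. k $ i \<in> \<int>) \<and> x + k \<in> cbox 0 1)" for x
  have \<tau>: "(\<forall>i. \<tau> x $ i \<in> \<int>) \<and> x + \<tau> x \<in> cbox 0 1" for x
    unfolding \<tau>_def by (rule someI_ex) (use integer_translate_in_unit_cube[of x] in blast)
  show ?thesis
  proof (rule that[OF k])
    fix e :: real assume "e > 0"
    then obtain N where N: "\<And>n x. n \<ge> N \<Longrightarrow> x \<in> cbox 0 1 \<Longrightarrow> norm (f (k n) x - g x) < e"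
      using conv by blast
    have "\<bar>f (k n) x - g (x + \<tau> x)\<bar> < e" if "n \<ge> N" for n x
    proof -
      have "f (k n) (x + \<tau> x) = f (k n) x"
        using per[of "k n"] \<tau>[of x] unfolding torus_periodic_def by blast
      then show ?thesis
        using N[OF that, of "x + \<tau> x"] \<tau>[of x] by simp
    qed
    then show "\<exists>N. \<forall>n\<ge>N. \<forall>x. \<bar>f (k n) x - g (x + \<tau> x)\<bar> < e"
      by blast
  qed
qed

lemma Linfty_norm_tendsto_zero:
  fixes u :: "real ^ 'n \<Rightarrow> real \<Rightarrow> real"
  assumes cont: "\<And>t. t \<ge> 0 \<Longrightarrow> continuous_on UNIV (\<lambda>x. u x t - v x)"
    and lim: "\<And>e. e > 0 \<Longrightarrow> \<exists>T. \<forall>t\<ge>T. \<forall>x. \<bar>u x t - v x\<bar> < e"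
  shows "((\<lambda>t. Linfty_norm (\<lambda>x. u x t - v x)) \<longlongrightarrow> 0) at_top"
proof (rule order_tendstoI)
  have meas: "(\<lambda>x. ereal \<bar>u x t - v x\<bar>) \<in> borel_measurable lborel" if "t \<ge> 0" for t
    using borel_measurable_continuous_onI[OF cont[OF that]] by measurable
  have nonneg: "0 \<le> Linfty_norm (\<lambda>x. u x t - v x)" for t
  proof -
    have "0 = esssup lborel (\<lambda>x :: real ^ 'n. 0 :: ereal)"
      by (subst esssup_const) simp_all
    also have "\<dots> \<le> Linfty_norm (\<lambda>x. u x t - v x)"
      unfolding Linfty_norm_def by (intro esssup_mono) auto
    finally show ?thesis .
  qed
  show "\<forall>\<^sub>F t in at_top. a < Linfty_norm (\<lambda>x. u x t - v x)" if "a < 0" for a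
    using that nonneg by (intro always_eventually allI) (metis less_le_trans)
  show "\<forall>\<^sub>F t in at_top. Linfty_norm (\<lambda>x. u x t - v x) < a" if a: "0 < a" for a
  proof -
    obtain e where e: "0 < ereal e" "ereal e < a"
      using ereal_dense2[OF a] by blast
    then obtain T where T: "\<And>t x. t \<ge> T \<Longrightarrow> \<bar>u x t - v x\<bar> < e"
      using lim[of e] by auto
    have "Linfty_norm (\<lambda>x. u x t - v x) < a" if "t \<ge> max T 0" for t
    proof -
      have "Linfty_norm (\<lambda>x. u x t - v x) \<le> ereal e"
        unfolding Linfty_norm_def using T[of t] that meas[of t]
        by (intro esssup_I) (auto intro!: always_eventually less_imp_le)
      with e(2) show ?thesis by simp
    qed
    then show ?thesis
      unfolding eventually_at_top_linorder by blast
  qed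
qed

text \<open>
  The dilated supersolution with \<open>l powr \<theta> * t = t + h\<close>, raised by \<open>(l - 1) * M\<close>, lies above \<open>u\<close>
  initially, hence at time \<open>t\<close>.
\<close>

lemma almost_increasing:
  fixes u :: "real ^ 'n \<Rightarrow> real \<Rightarrow> real"
  assumes ham: "torus_hamiltonian H" "sign_coercive H"
    and sol: "space_time_sub H u" "space_time_super H u" "torus_continuous u"
    and hom: "\<And>l x p. l \<ge> 1 \<Longrightarrow> H x (l *\<^sub>R p) \<ge> l powr (\<theta> + 1) * H x p" and "\<theta> > 0"
    and bound: "\<And>x t. t \<ge> 0 \<Longrightarrow> \<bar>u x t\<bar> \<le> M" and "t > 0" "h \<ge> 0"
  shows "u x t - 2 * M * ((1 + h / t) powr (1 / \<theta>) - 1) \<le> u x (t + h)"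
proof -
  define l where "l = (1 + h / t) powr (1 / \<theta>)"
  have "l \<ge> 1"
    using \<open>\<theta> > 0\<close> \<open>t > 0\<close> \<open>h \<ge> 0\<close> by (simp add: l_def ge_one_powr_ge_zero)
  have l\<theta>: "l powr \<theta> = 1 + h / t"
    using \<open>\<theta> > 0\<close> \<open>t > 0\<close> \<open>h \<ge> 0\<close> by (simp add: l_def powr_powr add_nonneg_pos)
  have "space_time_super H (\<lambda>x t. l * u x (l powr \<theta> * t))"
    by (rule space_time_super_dilate[OF sol(2) \<open>l \<ge> 1\<close> hom[OF \<open>l \<ge> 1\<close>]])
  from space_time_super_shift[OF this order_refl, of "(l - 1) * M"]
  have super: "space_time_super H (\<lambda>x t. l * u x (l powr \<theta> * t) + (l - 1) * M)"
    by simp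
  have cont: "torus_continuous (\<lambda>x t. l * u x (l powr \<theta> * t) + (l - 1) * M)"
    using torus_continuous_combine[OF sol(3), of "l powr \<theta>" 0 l 0 "(l - 1) * M"] by simp
  have "u x t \<le> l * u x (l powr \<theta> * t) + (l - 1) * M"
  proof (rule comparison_principle[OF ham sol(1) super sol(3) cont _ less_imp_le[OF \<open>t > 0\<close>]])
    fix x
    have "(l - 1) * (- M) \<le> (l - 1) * u x 0"
      using bound[of 0 x] \<open>l \<ge> 1\<close> by (intro mult_left_mono) (auto simp: abs_le_iff)
    then show "u x 0 \<le> l * u x (l powr \<theta> * 0) + (l - 1) * M"
      by (simp add: algebra_simps)
  qed
  also have "l powr \<theta> * t = t + h"
    using \<open>t > 0\<close> by (simp add: l\<theta> field_simps)
  finally have "u x t \<le> u x (t + h) + (l - 1) * u x (t + h) + (l - 1) * M"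
    by (simp add: algebra_simps)
  moreover have "(l - 1) * u x (t + h) \<le> (l - 1) * M"
    using bound[of "t + h" x] \<open>t > 0\<close> \<open>h \<ge> 0\<close> \<open>l \<ge> 1\<close> by (intro mult_left_mono) (auto simp: abs_le_iff)
  ultimately show ?thesis
    unfolding l_def[symmetric] by (simp add: algebra_simps)
qed

text \<open>
  The barriers \<open>u(\<cdot>, 0) \<plusminus> K * t\<close> bound the variation up to a first time \<open>h\<close>; by contraction the
  solution never moves more than that during any later time interval of length \<open>h\<close>.
\<close>

lemma lipschitz_in_time:
  fixes u :: "real ^ 'n \<Rightarrow> real \<Rightarrow> real"
  assumes ham: "torus_hamiltonian H" "sign_coercive H"
    and sol: "space_time_sub H u" "space_time_super H u" "torus_continuous u"
    and g: "\<And>x. GDERIV (\<lambda>x. u x 0) x :> Dg x" and K: "\<And>x. \<bar>H x (Dg x)\<bar> \<le> K"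
    and "t \<ge> 0" "s \<ge> 0"
  shows "\<bar>u x t - u x s\<bar> \<le> K * \<bar>t - s\<bar>"
proof -
  have per: "torus_periodic (\<lambda>x. u x 0)"
    using sol(3) by (simp add: torus_continuous_def)
  have "continuous_on UNIV (\<lambda>x. u x 0)"
    using g unfolding gderiv_def
    by (blast intro: continuous_at_imp_continuous_on has_derivative_continuous)
  then have c0: "torus_continuous (\<lambda>x t. u x 0)"
    using per by (rule torus_continuous_stationary)
  have start: "\<bar>u x h - u x 0\<bar> \<le> K * h" if "h \<ge> 0" for x h
  proof -
    have "torus_continuous (\<lambda>x t. u x 0 + K * t)" "torus_continuous (\<lambda>x t. u x 0 - K * t)"
      using torus_continuous_combine[OF c0, of 0 0 1 K 0] torus_continuous_combine[OF c0, of 0 0 1 "- K" 0]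
      by simp_all
    moreover have "space_time_super H (\<lambda>x t. u x 0 + K * t)"
      by (rule classical_super[OF g]) (use K in \<open>auto simp: abs_le_iff minus_le_iff\<close>)
    moreover have "space_time_sub H (\<lambda>x t. u x 0 - K * t)"
      by (rule classical_sub[OF g]) (use K in \<open>auto simp: abs_le_iff\<close>)
    ultimately have "u x h \<le> u x 0 + K * h" "u x 0 - K * h \<le> u x h"
      using comparison_principle[OF ham sol(1) _ sol(3), of "\<lambda>x t. u x 0 + K * t" h x]
        comparison_principle[OF ham _ sol(2) _ sol(3), of "\<lambda>x t. u x 0 - K * t" h x] that
      by auto
    then show ?thesis by (simp add: abs_le_iff)
  qed
  have later: "\<bar>u x (r + h) - u x r\<bar> \<le> K * h" if "h \<ge> 0" "r \<ge> 0" for r h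
    using solutions_contract[OF ham space_time_sub_shift[OF sol(1) that(1), of 0]
        space_time_super_shift[OF sol(2) that(1), of 0] torus_continuous_shift[OF sol(3) that(1), of 0]
        sol, of "K * h" r x] start[OF that(1)] that(2)
    by simp
  show ?thesis
    using later[of "t - s" s] later[of "s - t" t] assms(8,9)
    by (cases "s \<le> t") (auto simp: abs_minus_commute)
qed

text \<open>
  Compactness is used twice: for a sequence of times along which \<open>u\<close> converges, and to make the
  monotone convergence of the limiting evolution \<open>U\<close> uniform in space. Between the two,
  contraction upgrades convergence at the times \<open>k n\<close> to convergence that is uniform over all later
  times, so that \<open>u\<close> follows \<open>U\<close> forever.
\<close>

lemma bounded_lipschitz_solution_converges:
  fixes u :: "real ^ 'n \<Rightarrow> real \<Rightarrow> real"
  assumes ham: "torus_hamiltonian H" "sign_coercive H"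
    and sol: "space_time_sub H u" "space_time_super H u" "torus_continuous u"
    and hom: "\<And>l x p. l \<ge> 1 \<Longrightarrow> H x (l *\<^sub>R p) \<ge> l powr (\<theta> + 1) * H x p" and "\<theta> > 0"
    and bound: "\<And>x t. t \<ge> 0 \<Longrightarrow> \<bar>u x t\<bar> \<le> M"
    and lip: "\<And>x y t. t \<ge> 0 \<Longrightarrow> \<bar>u x t - u y t\<bar> \<le> L * norm (x - y)" and "L > 0"
  obtains v where "\<And>e. e > 0 \<Longrightarrow> \<exists>T\<ge>0. \<forall>t\<ge>T. \<forall>x. \<bar>u x t - v x\<bar> < e"
proof -
  have per: "torus_periodic (\<lambda>x. u x t)" if "t \<ge> 0" for t
    using sol(3) that by (simp add: torus_continuous_def)
  obtain k :: "nat \<Rightarrow> nat" and g where k: "strict_mono k"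
    and g: "\<And>e. e > 0 \<Longrightarrow> \<exists>N. \<forall>n\<ge>N. \<forall>x. \<bar>u x (real (k n)) - g x\<bar> < e"
    using periodic_lipschitz_uniform_subsequence[of "\<lambda>n x. u x (real n)" M L] per bound lip \<open>L > 0\<close> by auto
  have cauchy: "\<exists>N. \<forall>n\<ge>N. \<forall>m\<ge>N. \<forall>x. \<forall>t\<ge>0. \<bar>u x (t + real (k n)) - u x (t + real (k m))\<bar> \<le> e" if "e > 0" for e
  proof -
    have "e / 2 > 0" using that by simp
    from g[OF this] obtain N where N: "\<And>n x. n \<ge> N \<Longrightarrow> \<bar>u x (real (k n)) - g x\<bar> < e / 2"
      by blast
    have "\<bar>u x (t + real (k n)) - u x (t + real (k m))\<bar> \<le> e" if "n \<ge> N" "m \<ge> N" "t \<ge> 0" for n m x t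
    proof -
      have "\<bar>u x (0 + real (k n)) - u x (0 + real (k m))\<bar> \<le> e" for x
        using N[OF that(1), of x] N[OF that(2), of x] unfolding add_0 by linarith
      then show ?thesis
        using solutions_contract[OF ham space_time_sub_shift[OF sol(1), of "k n" 0]
            space_time_super_shift[OF sol(2), of "k n" 0] torus_continuous_shift[OF sol(3), of "k n" 0]
            space_time_sub_shift[OF sol(1), of "k m" 0]
            space_time_super_shift[OF sol(2), of "k m" 0] torus_continuous_shift[OF sol(3), of "k m" 0],
            of e t x] \<open>t \<ge> 0\<close>
        by simp
    qed
    then show ?thesis by blast
  qed
  define U where "U x t = lim (\<lambda>n. u x (t + real (k n)))" for x t
  have U: "(\<lambda>n. u x (t + real (k n))) \<longlonglongrightarrow> U x t" if "t \<ge> 0" for x t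
  proof -
    have "Cauchy (\<lambda>n. u x (t + real (k n)))"
      unfolding Cauchy_def
    proof (intro allI impI)
      fix e :: real assume "e > 0"
      then obtain N where "\<forall>n\<ge>N. \<forall>m\<ge>N. \<forall>x. \<forall>t\<ge>0. \<bar>u x (t + real (k n)) - u x (t + real (k m))\<bar> \<le> e / 2"
        using cauchy[of "e / 2"] by auto
      then have "\<forall>n\<ge>N. \<forall>m\<ge>N. dist (u x (t + real (k n))) (u x (t + real (k m))) < e"
        using \<open>e > 0\<close> that unfolding dist_real_def by (smt (verit) field_sum_of_halves)
      then show "\<exists>N. \<forall>m\<ge>N. \<forall>n\<ge>N. dist (u x (t + real (k m))) (u x (t + real (k n))) < e"
        by blast
    qed
    then show ?thesis
      unfolding U_def by (simp add: Cauchy_convergent_iff convergent_LIMSEQ_iff)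
  qed
  have U_approx: "\<exists>n. \<forall>x. \<forall>t\<ge>0. \<bar>u x (t + real (k n)) - U x t\<bar> \<le> e" if "e > 0" for e
  proof -
    obtain N where N: "\<forall>n\<ge>N. \<forall>m\<ge>N. \<forall>x. \<forall>t\<ge>0. \<bar>u x (t + real (k n)) - u x (t + real (k m))\<bar> \<le> e"
      using cauchy[OF \<open>e > 0\<close>] by blast
    have "\<bar>u x (t + real (k N)) - U x t\<bar> \<le> e" if "t \<ge> 0" for x t
    proof (rule LIMSEQ_le_const2)
      show "(\<lambda>m. \<bar>u x (t + real (k N)) - u x (t + real (k m))\<bar>) \<longlonglongrightarrow> \<bar>u x (t + real (k N)) - U x t\<bar>"
        by (intro tendsto_intros U that)
      show "\<exists>M. \<forall>m\<ge>M. \<bar>u x (t + real (k N)) - u x (t + real (k m))\<bar> \<le> e"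
        using N that by blast
    qed
    then show ?thesis by blast
  qed
  (* The error term of almost_increasing vanishes along k n, as t + k n tends to infinity. *)
  have U_mono: "U x t \<le> U x s" if "0 \<le> t" "t \<le> s" for x t s
  proof (rule LIMSEQ_le[OF _ U])
    have k_top: "filterlim (\<lambda>n. t + real (k n)) at_top sequentially"
      by (intro filterlim_tendsto_add_at_top[OF tendsto_const]
          filterlim_compose[OF filterlim_real_sequentially filterlim_subseq[OF k]])
    have "(\<lambda>n. (s - t) / (t + real (k n))) \<longlonglongrightarrow> 0"
      by (intro real_tendsto_divide_at_top[OF tendsto_const] k_top)
    then have powr_lim: "(\<lambda>n. (1 + (s - t) / (t + real (k n))) powr (1 / \<theta>)) \<longlonglongrightarrow> (1 + 0) powr (1 / \<theta>)"
      by (intro tendsto_intros) auto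
    have "(\<lambda>n. u x (t + real (k n)) - 2 * M * ((1 + (s - t) / (t + real (k n))) powr (1 / \<theta>) - 1))
        \<longlonglongrightarrow> U x t - 2 * M * ((1 + 0) powr (1 / \<theta>) - 1)"
      by (rule tendsto_diff[OF U[OF that(1)] tendsto_mult_left[OF tendsto_diff[OF powr_lim tendsto_const]]])
    then show "(\<lambda>n. u x (t + real (k n)) - 2 * M * ((1 + (s - t) / (t + real (k n))) powr (1 / \<theta>) - 1))
        \<longlonglongrightarrow> U x t"
      by simp
    show "0 \<le> s" using that by simp
    have "u x (t + real (k n)) - 2 * M * ((1 + (s - t) / (t + real (k n))) powr (1 / \<theta>) - 1) \<le> u x (s + real (k n))"
      if "n \<ge> 1" for n
    proof -
      have "t + real (k n) > 0"
        using seq_suble[OF k, of n] that \<open>0 \<le> t\<close> by linarith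
      from almost_increasing[OF ham sol hom \<open>\<theta> > 0\<close> bound this, of "s - t" x] \<open>t \<le> s\<close>
      show ?thesis by (simp add: algebra_simps)
    qed
    then show "\<exists>N. \<forall>n\<ge>N. u x (t + real (k n)) - 2 * M * ((1 + (s - t) / (t + real (k n))) powr (1 / \<theta>) - 1)
        \<le> u x (s + real (k n))"
      by blast
  qed
  have U_bound: "\<bar>U x t\<bar> \<le> M" if "t \<ge> 0" for x t
    by (rule LIMSEQ_le_const2[OF tendsto_rabs[OF U[OF that]]]) (use bound that in auto)
  have U_per: "torus_periodic (\<lambda>x. U x t)" if "t \<ge> 0" for t
    using per that unfolding U_def torus_periodic_def by simp
  have U_lip: "\<bar>U x t - U y t\<bar> \<le> L * norm (x - y)" if "t \<ge> 0" for x y t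
    by (rule LIMSEQ_le_const2[OF tendsto_rabs[OF tendsto_diff[OF U[OF that] U[OF that]]]])
      (use lip that in auto)
  obtain j :: "nat \<Rightarrow> nat" and v where j: "strict_mono j"
    and v: "\<And>e. e > 0 \<Longrightarrow> \<exists>N. \<forall>n\<ge>N. \<forall>x. \<bar>U x (real (j n)) - v x\<bar> < e"
    using periodic_lipschitz_uniform_subsequence[of "\<lambda>n x. U x (real n)" M L]
      U_per U_bound U_lip \<open>L > 0\<close> by auto
  have U_le_v: "U x t \<le> v x" if "t \<ge> 0" for x t
  proof (rule field_le_epsilon)
    fix e :: real assume "e > 0"
    obtain N where N: "\<forall>n\<ge>N. \<forall>x. \<bar>U x (real (j n)) - v x\<bar> < e"
      using v[OF \<open>e > 0\<close>] by blast
    define n where "n = max N (nat \<lceil>t\<rceil>)"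
    have "t \<le> real n"
      by (simp add: n_def) linarith
    also have "\<dots> \<le> real (j n)"
      using seq_suble[OF j, of n] by simp
    finally have "U x t \<le> U x (real (j n))"
      using that by (intro U_mono)
    moreover have "\<bar>U x (real (j n)) - v x\<bar> < e"
      using N by (simp add: n_def)
    ultimately show "U x t \<le> v x + e" by linarith
  qed
  show ?thesis
  proof (rule that)
    fix e :: real assume "e > 0"
    then have "e / 2 > 0" by simp
    obtain N where N: "\<forall>x. \<bar>U x (real (j N)) - v x\<bar> < e / 2"
      using v[OF \<open>e / 2 > 0\<close>] by blast
    have "e / 3 > 0" using \<open>e > 0\<close> by simp
    obtain n where n: "\<And>x t. t \<ge> 0 \<Longrightarrow> \<bar>u x (t + real (k n)) - U x t\<bar> \<le> e / 3"
      using U_approx[OF \<open>e / 3 > 0\<close>] by blast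
    have "\<bar>u x t - v x\<bar> < e" if "t \<ge> real (j N) + real (k n)" for t x
    proof -
      have "U x (real (j N)) \<le> U x (t - real (k n))" "U x (t - real (k n)) \<le> v x"
        using that by (auto intro!: U_mono U_le_v)
      moreover have "\<bar>u x ((t - real (k n)) + real (k n)) - U x (t - real (k n))\<bar> \<le> e / 3"
        using that by (intro n) simp
      moreover have "\<bar>U x (real (j N)) - v x\<bar> < e / 2"
        using N by blast
      ultimately show ?thesis
        using \<open>e > 0\<close> unfolding diff_add_cancel by linarith
    qed
    then show "\<exists>T\<ge>0. \<forall>t\<ge>T. \<forall>x. \<bar>u x t - v x\<bar> < e"
      by (intro exI[of _ "real (j N) + real (k n)"]) auto
  qed
qed

theorem theorem1p4:
  fixes H :: "real ^ 'n \<Rightarrow> real ^ 'n \<Rightarrow> real"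
    and g :: "real ^ 'n \<Rightarrow> real"
    and u :: "real ^ 'n \<Rightarrow> real \<Rightarrow> real"
  assumes H_C2: "C2_on UNIV (\<lambda>(x, p). H x p)"
    and H_periodic: "\<And>p. torus_periodic (\<lambda>x. H x p)"
    and g_C2: "C2_on UNIV g"
    and g_periodic: "torus_periodic g"
    and A1: "condition_A1 H"
    and A2: "condition_A2 H"
    and Hbar: "is_effective_Hamiltonian_at_0 H 0"
    and u_sol: "Cauchy_viscosity_solution H g u"
  shows "\<exists>v. stationary_viscosity_solution H 0 v \<and>
             (\<exists>L. L-lipschitz_on UNIV v) \<and>
             ((\<lambda>t. Linfty_norm (\<lambda>x. u x t - v x)) \<longlongrightarrow> 0) at_top"
proof -
  have H_C1: "C1_on UNIV (\<lambda>(x, p). H x p)"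
    by (rule C2_imp_C1[OF H_C2])
  then obtain GH where GH: "\<And>z. GDERIV (\<lambda>(x, p). H x p) z :> GH z"
    unfolding C1_on_iff_continuous_gradient by blast
  have contH: "continuous_on UNIV (\<lambda>(x, p). H x p)"
    using GH unfolding gderiv_def
    by (blast intro: continuous_at_imp_continuous_on has_derivative_continuous)
  have ham: "torus_hamiltonian H"
    using contH H_periodic by (simp add: torus_hamiltonian_def)
  have coer: "sign_coercive H"
    unfolding sign_coercive_def using A1_sign_coercive[OF H_C1 H_periodic A1] by metis
  obtain \<theta> where "\<theta> > 0" and \<theta>: "\<And>x p. gradient (\<lambda>q. H x q) p \<bullet> p \<ge> (\<theta> + 1) * H x p"
    using A2 unfolding condition_A2_def by blast
  have hom: "H x (l *\<^sub>R p) \<ge> l powr (\<theta> + 1) * H x p" if "l \<ge> 1" for l x p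
  proof (rule A2_superhomogeneous[OF _ _ that])
    fix q
    have D: "GDERIV (\<lambda>q. H x q) q :> snd (GH (x, q))"
      using GDERIV_snd_slice[OF GH[of "(x, q)"]] by simp
    then show "GDERIV (\<lambda>q. H x q) q :> snd (GH (x, q))" .
    show "(\<theta> + 1) * H x q \<le> snd (GH (x, q)) \<bullet> q"
      using \<theta>[of x q] by (simp add: gradient_eqI[OF D])
  qed
  have sol: "space_time_sub H u" "space_time_super H u" "torus_continuous u" and u0: "\<And>x. u x 0 = g x"
    using u_sol unfolding Cauchy_viscosity_solution_def torus_continuous_def
    by (auto intro: evolution_subsolution_imp_space_time_sub evolution_supersolution_imp_space_time_super)
  obtain Dg where Dg: "\<And>x. GDERIV g x :> Dg x" "continuous_on UNIV Dg"
    using C2_imp_C1[OF g_C2] unfolding C1_on_iff_continuous_gradient by blast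
  have Dg_per: "torus_periodic Dg"
    by (rule gradient_periodic[OF Dg(1) g_periodic])
  have contg: "continuous_on UNIV g"
    using Dg(1) unfolding gderiv_def
    by (blast intro: continuous_at_imp_continuous_on has_derivative_continuous)
  obtain K where K: "\<And>x. \<bar>H x (Dg x)\<bar> \<le> K"
  proof (rule periodic_bounded_single)
    show "continuous_on UNIV (\<lambda>x. H x (Dg x))"
      using continuous_on_compose2[OF contH continuous_on_Pair[OF continuous_on_id Dg(2)]] by simp
    show "torus_periodic (\<lambda>x. H x (Dg x))"
      using H_periodic Dg_per by (simp add: torus_periodic_def)
  qed blast
  have time: "\<bar>u x t - u x s\<bar> \<le> K * \<bar>t - s\<bar>" if "t \<ge> 0" "s \<ge> 0" for x t s
    using lipschitz_in_time[OF ham coer sol _ K that, of x] Dg(1) by (simp add: u0)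
  obtain L0 where L0: "\<And>x. \<bar>norm (Dg x)\<bar> \<le> L0"
    by (rule periodic_bounded_single[of "\<lambda>x. norm (Dg x)"])
      (use Dg_per in \<open>auto intro: continuous_on_norm Dg(2) simp: torus_periodic_def\<close>)
  have g_lip: "\<bar>u x 0 - u y 0\<bar> \<le> L0 * norm (x - y)" for x y
  proof -
    have "norm (g x - g y) \<le> L0 * norm (x - y)"
    proof (rule differentiable_bound[of UNIV g "\<lambda>x h. h \<bullet> Dg x"])
      show "(g has_derivative (\<lambda>h. h \<bullet> Dg x)) (at x within UNIV)" for x
        using Dg(1) by (simp add: gderiv_def)
      show "onorm (\<lambda>h. h \<bullet> Dg x) \<le> L0" for x
        using L0[of x] by (intro onorm_le) (metis Cauchy_Schwarz_ineq2 abs_norm_cancel mult.commute mult_right_mono norm_ge_zero order_trans real_norm_def)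
    qed auto
    then show ?thesis by (simp add: u0)
  qed
  obtain L where "L > 0" and lip: "\<And>x y t. t \<ge> 0 \<Longrightarrow> \<bar>u x t - u y t\<bar> \<le> L * norm (x - y)"
    using uniform_lipschitz_in_space[OF coer sol time g_lip] by blast
  obtain v0 where v0: "stationary_viscosity_solution H 0 v0"
    using Hbar unfolding is_effective_Hamiltonian_at_0_def by blast
  obtain B1 where B1: "\<And>x. \<bar>v0 x\<bar> \<le> B1"
    using periodic_bounded_single[of v0] v0 unfolding stationary_viscosity_solution_def by blast
  obtain B2 where B2: "\<And>x. \<bar>g x\<bar> \<le> B2"
    using periodic_bounded_single[OF contg g_periodic] by blast
  have bound: "\<bar>u x t\<bar> \<le> B2 + B1 + B1" if "t \<ge> 0" for x t
  proof -
    have "\<bar>u x t - v0 x\<bar> \<le> B2 + B1"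
    proof (rule solutions_contract[OF ham coer sol _ _ _ _ that, where w = "\<lambda>x t. v0 x"])
      show "space_time_sub H (\<lambda>x t. v0 x)" "space_time_super H (\<lambda>x t. v0 x)" "torus_continuous (\<lambda>x t. v0 x)"
        using v0 unfolding stationary_viscosity_solution_def
        by (auto simp: space_time_sub_iff_stationary space_time_super_iff_stationary
            intro: torus_continuous_stationary)
      show "\<bar>u x 0 - v0 x\<bar> \<le> B2 + B1" for x
        using B1[of x] B2[of x] by (simp add: u0)
    qed
    with B1[of x] show ?thesis by linarith
  qed
  obtain v where v: "\<And>e. e > 0 \<Longrightarrow> \<exists>T\<ge>0. \<forall>t\<ge>T. \<forall>x. \<bar>u x t - v x\<bar> < e"
    using bounded_lipschitz_solution_converges[OF ham coer sol hom \<open>\<theta> > 0\<close> bound lip \<open>L > 0\<close>] by blast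
  have v_limit: "((\<lambda>t. u x t) \<longlongrightarrow> v x) at_top" for x
    unfolding tendsto_iff dist_real_def eventually_at_top_linorder using v by blast
  have nonneg_ev: "\<forall>\<^sub>F t::real in at_top. t \<ge> 0"
    by (rule eventually_ge_at_top)
  have v_lip: "L-lipschitz_on UNIV v"
  proof (rule lipschitz_onI)
    show "dist (v x) (v y) \<le> L * dist x y" for x y
      unfolding dist_real_def dist_norm
      by (rule tendsto_upperbound[OF tendsto_rabs[OF tendsto_diff[OF v_limit v_limit]]])
        (auto intro: eventually_mono[OF nonneg_ev lip])
  qed (use \<open>L > 0\<close> in simp)
  have contv: "continuous_on UNIV v"
    by (rule lipschitz_on_continuous_on[OF v_lip])
  have per_v: "torus_periodic v"
    unfolding torus_periodic_def
  proof (intro allI impI)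
    fix x k :: "real ^ 'n" assume "\<forall>i. k $ i \<in> \<int>"
    then have "\<forall>\<^sub>F t in at_top. u (x + k) t = u x t"
      using sol(3) by (intro eventually_mono[OF nonneg_ev]) (simp add: torus_continuous_def torus_periodic_def)
    then show "v (x + k) = v x"
      using tendsto_unique[OF trivial_limit_at_top_linorder v_limit[of "x + k"]] v_limit[of x]
      by (simp add: tendsto_cong)
  qed
  (* The time translates of u converge to v uniformly on all of space-time. *)
  have late: "\<exists>n::nat. \<forall>x. \<forall>t\<ge>0. \<bar>(u x (t + real n) + 0) - v x\<bar> < e" if "e > 0" for e
  proof -
    obtain T where T: "\<forall>t\<ge>T. \<forall>x. \<bar>u x t - v x\<bar> < e"
      using v[OF \<open>e > 0\<close>] by blast
    obtain n :: nat where "T \<le> real n"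
      using real_arch_simple by blast
    with T have "\<forall>x. \<forall>t\<ge>0. \<bar>(u x (t + real n) + 0) - v x\<bar> < e"
      by simp
    then show ?thesis by blast
  qed
  have "space_time_sub H (\<lambda>x t. v x)"
    by (rule space_time_sub_limit[OF contH, of "\<lambda>n x t. u x (t + real n) + 0"])
      (intro space_time_sub_shift sol torus_continuous_shift late; simp)+
  moreover have "space_time_super H (\<lambda>x t. v x)"
    by (rule space_time_super_limit[OF contH, of "\<lambda>n x t. u x (t + real n) + 0"])
      (intro space_time_super_shift sol torus_continuous_shift late; simp)+
  ultimately have "stationary_viscosity_solution H 0 v"
    using contv per_v
    by (simp add: stationary_viscosity_solution_def space_time_sub_iff_stationary space_time_super_iff_stationary)
  moreover have "((\<lambda>t. Linfty_norm (\<lambda>x. u x t - v x)) \<longlongrightarrow> 0) at_top"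
  proof (rule Linfty_norm_tendsto_zero)
    show "continuous_on UNIV (\<lambda>x. u x t - v x)" if "t \<ge> 0" for t
    proof -
      have "L-lipschitz_on UNIV (\<lambda>x. u x t)"
        by (rule lipschitz_onI) (use lip[OF that] \<open>L > 0\<close> in \<open>auto simp: dist_real_def dist_norm\<close>)
      then show ?thesis
        by (intro continuous_on_diff contv lipschitz_on_continuous_on)
    qed
    show "\<exists>T. \<forall>t\<ge>T. \<forall>x. \<bar>u x t - v x\<bar> < e" if "e > 0" for e
      using v[OF that] by blast
  qed
  ultimately show ?thesis
    using v_lip by blast
qed

end
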